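(* Let $\mathcal X_i=\Delta^{d_i}$ for all $i$. Let $G$ be one of the following: (1) the $\alpha$-divergence $G(\pi_i,\sigma_i)=\frac{1}{\alpha(1-\alpha)}\big(1-\sum_{j=1}^{d_i}\pi_{ij}^{\alpha}\sigma_{ij}^{1-\alpha}\big)$ with $\alpha\in(0,1)$; (2) the Rényi divergence $G(\pi_i,\sigma_i)=\frac{1}{\alpha-1}\ln\big(\sum_{j=1}^{d_i}\pi_{ij}^{\alpha}\sigma_{ij}^{1-\alpha}\big)$ with $\alpha\in(0,1)$; (3) the reverse KL divergence $G(\pi_i,\sigma_i)=\mathrm{KL}(\sigma_i,\pi_i)=\sum_j\sigma_{ij}\ln(\sigma_{ij}/\pi_{ij})$. Fix $\mu>0$, let $\sigma^0$ lie in the interior of $\mathcal X$, and define $\sigma^{k+1}=\pi^{\mu,\sigma^k}$ for $k\ge0$. Then $\sigma^k$ converges to the set $\Pi^*$ of Nash equilibria, in the sense that $\min_{\pi^*\in\Pi^*}\mathrm{KL}(\pi^*,\sigma^k)\to0$ as $k\to\infty$.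
   Context: Game. Let $N\ge1$. $\Delta^d=\{p\in[0,1]^d:\sum_jp_j=1\}$ denotes the probability simplex, and $\mathcal X=\prod_i\mathcal X_i$. Each $v_i:\mathcal X\to\mathbb R$ is differentiable, with block gradient $\nabla_{\pi_i}v_i$. The game is monotone: $\sum_i\langle\nabla_{\pi_i}v_i(\pi)-\nabla_{\pi_i}v_i(\pi'),\pi_i-\pi_i'\rangle\le0$ for all $\pi,\pi'$. A Nash equilibrium is a $\pi^*$ with $v_i(\pi^* )\ge v_i(\pi_i,\pi^*_{-i})$ for all $i$ and $\pi_i\in\mathcal X_i$. $\Pi^*$ is the set of Nash equilibria. KL divergence: $\mathrm{KL}(\pi,\pi')=\sum_i\sum_j\pi_{ij}\ln(\pi_{ij}/\pi'_{ij})$. Perturbed equilibrium. For $\mu>0$ and $\sigma\in\mathcal X$, $\pi^{\mu,\sigma}$ is the profile with $\pi_i^{\mu,\sigma}\in\arg\max_{\pi_i\in\mathcal X_i}\{v_i(\pi_i,\pi^{\mu,\sigma}_{-i})-\mu G(\pi_i,\sigma_i)\}$ for all $i$. *)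

theory Defs
  imports "HOL-Analysis.Analysis"
begin

text \<open>Players are the elements of a finite type 'n; action labels come from a finite
  type 'a; player i uses the nonempty action set A i.  A strategy profile is a vector
  in real^('n \<times> 'a); coordinate (i,j) is the probability player i puts on action j,
  and coordinates (i,j) with j outside A i are 0.\<close>

type_synonym ('n,'a) profile = "real ^ ('n \<times> 'a)"

definition strat_space :: "('n::finite \<Rightarrow> 'a::finite set) \<Rightarrow> ('n,'a) profile set" where
  "strat_space A = {\<pi>. \<forall>i. (\<forall>j\<in>A i. 0 \<le> \<pi> $ (i,j)) \<and> (\<Sum>j\<in>A i. \<pi> $ (i,j)) = 1
                         \<and> (\<forall>j. j \<notin> A i \<longrightarrow> \<pi> $ (i,j) = 0)}"

definition strat_interior :: "('n::finite \<Rightarrow> 'a::finite set) \<Rightarrow> ('n,'a) profile set" where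
  "strat_interior A = {\<pi> \<in> strat_space A. \<forall>i. \<forall>j\<in>A i. 0 < \<pi> $ (i,j)}"

definition block :: "('n::finite,'a::finite) profile \<Rightarrow> 'n \<Rightarrow> 'a \<Rightarrow> real" where
  "block \<pi> i = (\<lambda>j. \<pi> $ (i,j))"

definition block_upd :: "'n \<Rightarrow> ('n::finite,'a::finite) profile \<Rightarrow> ('n,'a) profile \<Rightarrow> ('n,'a) profile" where
  "block_upd i p \<pi> = (\<chi> k. if fst k = i then p $ k else \<pi> $ k)"

definition nash_equilibria ::
  "('n::finite \<Rightarrow> 'a::finite set) \<Rightarrow> ('n \<Rightarrow> ('n,'a) profile \<Rightarrow> real) \<Rightarrow> ('n,'a) profile set" where
  "nash_equilibria A v = {\<pi>s \<in> strat_space A.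
      \<forall>i. \<forall>p\<in>strat_space A. v i (block_upd i p \<pi>s) \<le> v i \<pi>s}"

definition KL :: "('n::finite \<Rightarrow> 'a::finite set) \<Rightarrow> ('n,'a) profile \<Rightarrow> ('n,'a) profile \<Rightarrow> real" where
  "KL A \<pi> \<pi>' = (\<Sum>i\<in>UNIV. \<Sum>j\<in>A i. \<pi> $ (i,j) * ln (\<pi> $ (i,j) / \<pi>' $ (i,j)))"

text \<open>Divergences G(pi_i, sigma_i) on one simplex (action set B), valued in the extended
  reals so that infinite values are represented faithfully.\<close>

definition alpha_div :: "real \<Rightarrow> 'a set \<Rightarrow> ('a \<Rightarrow> real) \<Rightarrow> ('a \<Rightarrow> real) \<Rightarrow> ereal" where
  "alpha_div \<alpha> B p s =
     ereal (1 / (\<alpha> * (1 - \<alpha>)) * (1 - (\<Sum>j\<in>B. p j powr \<alpha> * s j powr (1 - \<alpha>))))"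

definition renyi_div :: "real \<Rightarrow> 'a set \<Rightarrow> ('a \<Rightarrow> real) \<Rightarrow> ('a \<Rightarrow> real) \<Rightarrow> ereal" where
  "renyi_div \<alpha> B p s =
     (let S = (\<Sum>j\<in>B. p j powr \<alpha> * s j powr (1 - \<alpha>))
      in if S = 0 then \<infinity> else ereal (1 / (\<alpha> - 1) * ln S))"

definition rev_KL :: "'a set \<Rightarrow> ('a \<Rightarrow> real) \<Rightarrow> ('a \<Rightarrow> real) \<Rightarrow> ereal" where
  "rev_KL B p s =
     (if \<exists>j\<in>B. 0 < s j \<and> p j = 0 then \<infinity>
      else ereal (\<Sum>j\<in>B. s j * ln (s j / p j)))"

definition perturbed_eq ::
  "('n::finite \<Rightarrow> 'a::finite set) \<Rightarrow> ('n \<Rightarrow> ('n,'a) profile \<Rightarrow> real)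
   \<Rightarrow> ('a set \<Rightarrow> ('a \<Rightarrow> real) \<Rightarrow> ('a \<Rightarrow> real) \<Rightarrow> ereal) \<Rightarrow> real
   \<Rightarrow> ('n,'a) profile \<Rightarrow> ('n,'a) profile \<Rightarrow> bool" where
  "perturbed_eq A v G \<mu> \<sigma> \<pi> \<longleftrightarrow> \<pi> \<in> strat_space A \<and>
     (\<forall>i. \<forall>p\<in>strat_space A.
        ereal (v i (block_upd i p \<pi>)) - ereal \<mu> * G (A i) (block p i) (block \<sigma> i)
        \<le> ereal (v i \<pi>) - ereal \<mu> * G (A i) (block \<pi> i) (block \<sigma> i))"

end

theory Submission
  imports Defs
begin

text \<open>Write \<open>a\<^sub>i\<^sub>j(\<pi>)\<close> for the advantage of action \<open>j\<close> of player \<open>i\<close> at \<open>\<pi>\<close>, the derivative of \<open>v\<^sub>i\<close> in the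
  direction of that vertex. For all three divergences the first-order condition at
  \<open>\<sigma>' = \<sigma> (Suc k)\<close> reads \<open>a\<^sub>i\<^sub>j(\<sigma>') = c (s\<^sub>i - (\<sigma>\<^sub>i\<^sub>j / \<sigma>'\<^sub>i\<^sub>j) powr \<beta> / t\<^sub>i)\<close> with \<open>s\<^sub>i, t\<^sub>i\<close> in \<open>(0, 1]\<close>, and
  \<open>ln x \<le> x - 1\<close> turns it into an energy inequality for \<open>KL(p, \<sigma>)\<close>, for every \<open>p\<close>.

  Summing it and using monotonicity, a limit point \<open>q\<close> of the averages of the \<open>\<sigma> k\<close> solves the Minty
  inequality; hence \<open>KL(q, \<sigma> k)\<close> decreases, its dissipation tends to \<open>0\<close>, and \<open>\<sigma> / \<sigma>'\<close> tends to \<open>1\<close> on the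
  support of \<open>q\<close>. Since the averages put vanishing mass off that support, some limit point \<open>x\<close> of
  the sequence itself is supported in it.

  The point \<open>x\<close> is a Nash equilibrium. Otherwise let \<open>b k\<close> be the mass of \<open>\<sigma> k\<close> on the actions with
  \<open>a\<^sub>i\<^sub>j(x) > 0\<close>. Near \<open>x\<close> this mass grows geometrically, while \<open>K k = KL(x, \<sigma> k)\<close> increases by at most a
  multiple of \<open>b\<close> per step. So \<open>K\<close> is controlled by \<open>b\<close> and must itself have grown geometrically by the
  time the sequence leaves the neighbourhood of \<open>x\<close>; but \<open>K\<close> only sees the ratios on the support of
  \<open>q\<close>, so its increments tend to \<open>0\<close>. Once \<open>x\<close> is Nash, \<open>KL(x, \<sigma> k)\<close> is decreasing and tends to \<open>0\<close> along a
  subsequence, hence tends to \<open>0\<close>.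

  No continuity of the gradients is available: a differentiable concave payoff may have a gradient
  that is discontinuous at the boundary. Lower semicontinuity of the advantages is enough.\<close>

section \<open>Monotone games\<close>

lemma strat_spaceD:
  assumes "\<pi> \<in> strat_space A"
  shows "0 \<le> \<pi> $ (i, j)" "(\<Sum>j\<in>A i. \<pi> $ (i, j)) = 1" "j \<notin> A i \<Longrightarrow> \<pi> $ (i, j) = 0"
  using assms by (cases "j \<in> A i"; auto simp: strat_space_def)+

lemma strat_space_le_1:
  assumes "\<pi> \<in> strat_space A" shows "\<pi> $ (i, j) \<le> 1"
proof (cases "j \<in> A i")
  case True
  have "\<pi> $ (i, j) \<le> (\<Sum>j\<in>A i. \<pi> $ (i, j))"
    using True strat_spaceD[OF assms] by (intro member_le_sum) auto
  then show ?thesis using strat_spaceD[OF assms] by simp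
qed (use strat_spaceD[OF assms] in simp)

lemma convex_strat_space: "convex (strat_space A)"
  unfolding convex_def strat_space_def
  by (auto simp: sum.distrib sum_distrib_left[symmetric])

lemma compact_strat_space: "compact (strat_space A)"
proof -
  have "bounded (strat_space A)"
    unfolding bounded_iff
  proof (intro exI ballI)
    fix \<pi> assume \<pi>: "\<pi> \<in> strat_space A"
    have "norm \<pi> \<le> (\<Sum>k\<in>UNIV. \<bar>\<pi> $ k\<bar>)" by (rule norm_le_l1_cart)
    also have "\<dots> \<le> (\<Sum>k\<in>(UNIV :: ('a \<times> 'b) set). 1)"
      by (intro sum_mono) (use strat_spaceD(1)[OF \<pi>] strat_space_le_1[OF \<pi>] in \<open>auto simp: abs_le_iff intro: order_trans[of _ 0]\<close>)
    finally show "norm \<pi> \<le> (\<Sum>k\<in>(UNIV :: ('a \<times> 'b) set). 1)" .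
  qed
  moreover have "strat_space A = (\<Inter>i. (\<Inter>j\<in>A i. {\<pi>. 0 \<le> \<pi> $ (i, j)}) \<inter> {\<pi>. (\<Sum>j\<in>A i. \<pi> $ (i, j)) = 1}
      \<inter> (\<Inter>j\<in>- A i. {\<pi>. \<pi> $ (i, j) = 0}))"
    by (auto simp: strat_space_def)
  moreover have "closed \<dots>"
    by (intro closed_INT ballI closed_Int closed_Collect_le closed_Collect_eq continuous_intros)
  ultimately show ?thesis by (simp add: compact_eq_bounded_closed)
qed

lemma inner_block:
  fixes x h :: "('n::finite, 'a::finite) profile"
  assumes "\<And>l m. l \<noteq> i \<or> m \<notin> B \<Longrightarrow> h $ (l, m) = 0"
  shows "x \<bullet> h = (\<Sum>j\<in>B. x $ (i, j) * h $ (i, j))"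
proof -
  have "x \<bullet> h = (\<Sum>k\<in>UNIV. x $ k * h $ k)" by (simp add: inner_vec_def)
  also have "\<dots> = (\<Sum>k\<in>{i} \<times> B. x $ k * h $ k)"
    by (rule sum.mono_neutral_right) (auto, (metis assms)+)
  also have "\<dots> = (\<Sum>l\<in>{i}. \<Sum>j\<in>B. x $ (l, j) * h $ (l, j))"
    by (subst sum.cartesian_product) (auto intro: sum.cong)
  finally show ?thesis by simp
qed

definition vertex_dir :: "'n \<Rightarrow> 'a \<Rightarrow> ('n::finite, 'a::finite) profile \<Rightarrow> ('n, 'a) profile" where
  "vertex_dir i j \<pi> = (\<chi> k. if fst k = i then (if snd k = j then 1 else 0) - \<pi> $ k else 0)"

lemma vertex_dir_nth:
  "vertex_dir i j \<pi> $ (l, m) = (if l = i then (if m = j then 1 else 0) - \<pi> $ (l, m) else 0)"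
  by (simp add: vertex_dir_def)

lemma vertex_dir_in:
  assumes \<pi>: "\<pi> \<in> strat_space A" and j: "j \<in> A i" and t: "t \<le> 1" "0 \<le> \<pi> $ (i, j) + t * (1 - \<pi> $ (i, j))"
  shows "\<pi> + t *\<^sub>R vertex_dir i j \<pi> \<in> strat_space A"
proof -
  have "0 \<le> \<pi> $ (l, m) + t * (vertex_dir i j \<pi> $ (l, m))" for l m
  proof -
    have "0 \<le> (1 - t) * \<pi> $ (l, m)" using strat_spaceD[OF \<pi>] t by simp
    then have "0 \<le> \<pi> $ (l, m) - t * \<pi> $ (l, m)" by (simp add: algebra_simps)
    then show ?thesis using t strat_spaceD(1)[OF \<pi>] by (auto simp: vertex_dir_nth)
  qed
  moreover have "(\<Sum>m\<in>A l. \<pi> $ (l, m) + t * vertex_dir i j \<pi> $ (l, m)) = 1" for l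
  proof -
    have "(\<Sum>m\<in>A l. vertex_dir i j \<pi> $ (l, m)) = 0"
      using strat_spaceD(2)[OF \<pi>, of l] j by (cases "l = i") (simp_all add: vertex_dir_nth sum_subtractf)
    then show ?thesis using strat_spaceD(2)[OF \<pi>] by (simp add: sum.distrib sum_distrib_left[symmetric])
  qed
  moreover have "\<pi> $ (l, m) + t * vertex_dir i j \<pi> $ (l, m) = 0" if "m \<notin> A l" for l m
    using strat_spaceD(3)[OF \<pi>] that j by (auto simp: vertex_dir_nth)
  ultimately show ?thesis by (auto simp: strat_space_def)
qed

definition pairing where
  "pairing A g \<pi> p = (\<Sum>i\<in>UNIV. \<Sum>j\<in>A i. g i \<pi> $ (i, j) * (p $ (i, j) - \<pi> $ (i, j) :: real))"

definition advantage where
  "advantage A g i j \<pi> = g i \<pi> $ (i, j) - (\<Sum>l\<in>A i. g i \<pi> $ (i, l) * \<pi> $ (i, l) :: real)"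

lemma sum_advantage:
  assumes "p \<in> strat_space A"
  shows "(\<Sum>j\<in>A i. p $ (i, j) * advantage A g i j \<pi>) = (\<Sum>j\<in>A i. g i \<pi> $ (i, j) * (p $ (i, j) - \<pi> $ (i, j)))"
proof -
  define E where "E = (\<Sum>l\<in>A i. g i \<pi> $ (i, l) * \<pi> $ (i, l))"
  have "(\<Sum>j\<in>A i. p $ (i, j) * advantage A g i j \<pi>) = (\<Sum>j\<in>A i. g i \<pi> $ (i, j) * p $ (i, j)) - (\<Sum>j\<in>A i. p $ (i, j)) * E"
    unfolding advantage_def E_def[symmetric] by (simp add: algebra_simps sum_subtractf sum_distrib_left sum_distrib_right)
  then show ?thesis using strat_spaceD(2)[OF assms] by (simp add: E_def algebra_simps sum_subtractf)
qed

lemma pairing_eq_advantage: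
  "p \<in> strat_space A \<Longrightarrow> pairing A g \<pi> p = (\<Sum>i\<in>UNIV. \<Sum>j\<in>A i. p $ (i, j) * advantage A g i j \<pi>)"
  by (simp add: pairing_def sum_advantage)

lemma inner_vertex_dir:
  assumes \<pi>: "\<pi> \<in> strat_space A" and j: "j \<in> A i"
  shows "g i \<pi> \<bullet> vertex_dir i j \<pi> = advantage A g i j \<pi>"
proof -
  have "g i \<pi> \<bullet> vertex_dir i j \<pi> = (\<Sum>m\<in>A i. g i \<pi> $ (i, m) * vertex_dir i j \<pi> $ (i, m))"
    using strat_spaceD(3)[OF \<pi>] j by (intro inner_block) (auto simp: vertex_dir_nth)
  also have "\<dots> = (\<Sum>m\<in>A i. (if m = j then g i \<pi> $ (i, m) else 0) - g i \<pi> $ (i, m) * \<pi> $ (i, m))"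
    by (intro sum.cong) (auto simp: vertex_dir_nth right_diff_distrib)
  also have "\<dots> = advantage A g i j \<pi>"
    using j by (simp add: advantage_def sum_subtractf)
  finally show ?thesis .
qed

lemma block_upd_nth: "block_upd i p \<pi> $ (l, m) = (if l = i then p $ (l, m) else \<pi> $ (l, m))"
  by (simp add: block_upd_def)

lemma block_upd_in:
  assumes "p \<in> strat_space A" "\<pi> \<in> strat_space A"
  shows "block_upd i p \<pi> \<in> strat_space A"
proof -
  have "(\<Sum>m\<in>A l. block_upd i p \<pi> $ (l, m)) = 1" for l
    using strat_spaceD(2)[OF assms(1)] strat_spaceD(2)[OF assms(2)]
    by (cases "l = i") (simp_all add: block_upd_nth)
  then show ?thesis
    using strat_spaceD(1,3)[OF assms(1)] strat_spaceD(1,3)[OF assms(2)]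
    by (simp add: strat_space_def block_upd_nth)
qed

locale monotone_game =
  fixes A :: "'n::finite \<Rightarrow> 'a::finite set"
    and v :: "'n \<Rightarrow> ('n,'a) profile \<Rightarrow> real"
    and g :: "'n \<Rightarrow> ('n,'a) profile \<Rightarrow> ('n,'a) profile"
  assumes A_ne: "\<And>i. A i \<noteq> {}"
    and diff: "\<And>i \<pi>. \<pi> \<in> strat_space A \<Longrightarrow>
                 (v i has_derivative (\<lambda>h. g i \<pi> \<bullet> h)) (at \<pi> within strat_space A)"
    and monotone: "\<And>\<pi> \<pi>'. \<pi> \<in> strat_space A \<Longrightarrow> \<pi>' \<in> strat_space A \<Longrightarrow>
                 (\<Sum>i\<in>UNIV. \<Sum>j\<in>A i. (g i \<pi> $ (i,j) - g i \<pi>' $ (i,j)) * (\<pi> $ (i,j) - \<pi>' $ (i,j))) \<le> 0"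
begin

abbreviation "X \<equiv> strat_space A"
abbreviation "adv \<equiv> advantage A g"
abbreviation "W \<equiv> pairing A g"

lemma continuous_v: "continuous_on X (v i)"
  unfolding continuous_on_eq_continuous_within using has_derivative_continuous[OF diff] by blast

lemma line_deriv:
  assumes "\<And>s. s \<in> T \<Longrightarrow> \<pi> + s *\<^sub>R d \<in> X" "s0 \<in> T"
  shows "((\<lambda>s. v i (\<pi> + s *\<^sub>R d)) has_derivative (\<lambda>h. g i (\<pi> + s0 *\<^sub>R d) \<bullet> (h *\<^sub>R d))) (at s0 within T)"
proof -
  have 1: "((\<lambda>s. \<pi> + s *\<^sub>R d) has_derivative (\<lambda>h. h *\<^sub>R d)) (at s0 within T)"
    by (auto intro!: derivative_eq_intros)
  have "(v i has_derivative (\<lambda>h. g i (\<pi> + s0 *\<^sub>R d) \<bullet> h)) (at (\<pi> + s0 *\<^sub>R d) within (\<lambda>s. \<pi> + s *\<^sub>R d) ` T)"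
    by (rule has_derivative_subset[OF diff]) (use assms in auto)
  from has_derivative_in_compose[OF 1 this] show ?thesis .
qed

lemma pairing_swap: "\<pi> \<in> X \<Longrightarrow> p \<in> X \<Longrightarrow> 0 \<le> W \<pi> p + W p \<pi>"
  using monotone[of p \<pi>] by (simp add: pairing_def algebra_simps sum_subtractf sum.distrib)

lemma block_mvt:
  assumes \<pi>: "\<pi> \<in> X" and \<pi>': "\<pi>' \<in> X" and off: "\<And>l m. l \<noteq> i \<Longrightarrow> \<pi>' $ (l, m) = \<pi> $ (l, m)"
  shows "\<exists>s. 0 < s \<and> s < 1 \<and> \<pi> + s *\<^sub>R (\<pi>' - \<pi>) \<in> X \<and>
     v i \<pi>' - v i \<pi> = (\<Sum>j\<in>A i. g i (\<pi> + s *\<^sub>R (\<pi>' - \<pi>)) $ (i, j) * (\<pi>' $ (i, j) - \<pi> $ (i, j)))"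
proof -
  have seg: "\<pi> + s *\<^sub>R (\<pi>' - \<pi>) \<in> X" if "s \<in> {0..1}" for s
    using convexD_alt[OF convex_strat_space \<pi> \<pi>', of s] that by (simp add: algebra_simps)
  obtain s where s: "s \<in> {0<..<1::real}"
    "v i (\<pi> + 1 *\<^sub>R (\<pi>' - \<pi>)) - v i (\<pi> + 0 *\<^sub>R (\<pi>' - \<pi>)) = g i (\<pi> + s *\<^sub>R (\<pi>' - \<pi>)) \<bullet> ((1 - 0) *\<^sub>R (\<pi>' - \<pi>))"
    using mvt_simple[of 0 1 "\<lambda>s. v i (\<pi> + s *\<^sub>R (\<pi>' - \<pi>))"
        "\<lambda>s h. g i (\<pi> + s *\<^sub>R (\<pi>' - \<pi>)) \<bullet> (h *\<^sub>R (\<pi>' - \<pi>))"]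
      line_deriv[of "{0..1}" \<pi> "\<pi>' - \<pi>" _ i] seg by auto
  have "g i (\<pi> + s *\<^sub>R (\<pi>' - \<pi>)) \<bullet> (\<pi>' - \<pi>)
     = (\<Sum>j\<in>A i. g i (\<pi> + s *\<^sub>R (\<pi>' - \<pi>)) $ (i, j) * (\<pi>' - \<pi>) $ (i, j))"
    using off strat_spaceD(3)[OF \<pi>] strat_spaceD(3)[OF \<pi>']
    by (intro inner_block) (metis diff_self vector_minus_component)
  with s seg[of s] show ?thesis by (intro exI[of _ s]) auto
qed

lemma block_concave:
  assumes \<pi>: "\<pi> \<in> X" and \<pi>': "\<pi>' \<in> X" and off: "\<And>l m. l \<noteq> i \<Longrightarrow> \<pi>' $ (l, m) = \<pi> $ (l, m)"
  shows "v i \<pi>' - v i \<pi> \<le> (\<Sum>j\<in>A i. g i \<pi> $ (i, j) * (\<pi>' $ (i, j) - \<pi> $ (i, j)))"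
proof -
  obtain s where s: "0 < s" "s < 1" and in_X: "\<pi> + s *\<^sub>R (\<pi>' - \<pi>) \<in> X"
    and eq: "v i \<pi>' - v i \<pi> = (\<Sum>j\<in>A i. g i (\<pi> + s *\<^sub>R (\<pi>' - \<pi>)) $ (i, j) * (\<pi>' $ (i, j) - \<pi> $ (i, j)))"
    using block_mvt[OF assms] by blast
  define x where "x = \<pi> + s *\<^sub>R (\<pi>' - \<pi>)"
  define D where "D l = (\<Sum>j\<in>A l. (g l x $ (l, j) - g l \<pi> $ (l, j)) * (\<pi>' $ (l, j) - \<pi> $ (l, j)))" for l
  have "(\<Sum>l\<in>UNIV. \<Sum>j\<in>A l. (g l x $ (l, j) - g l \<pi> $ (l, j)) * (x $ (l, j) - \<pi> $ (l, j))) = s * (\<Sum>l\<in>UNIV. D l)"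
    unfolding D_def sum_distrib_left by (intro sum.cong refl) (simp add: x_def)
  also have "(\<Sum>l\<in>UNIV. D l) = (\<Sum>l\<in>{i}. D l)"
    by (rule sum.mono_neutral_right) (auto simp: D_def off)
  finally have "s * D i \<le> 0" using monotone[of x \<pi>] \<pi> in_X by (simp add: x_def)
  then have "D i \<le> 0" using s by (simp add: mult_le_0_iff)
  then show ?thesis unfolding eq x_def[symmetric] D_def by (simp add: left_diff_distrib sum_subtractf)
qed

lemma advantage_lower:
  assumes \<pi>: "\<pi> \<in> X" and j: "j \<in> A i" and t: "0 < t" "t \<le> 1"
  shows "(v i (\<pi> + t *\<^sub>R vertex_dir i j \<pi>) - v i \<pi>) / t \<le> adv i j \<pi>"
proof -
  let ?\<pi>' = "\<pi> + t *\<^sub>R vertex_dir i j \<pi>"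
  have "?\<pi>' \<in> X" using \<pi> j t strat_spaceD(1)[OF \<pi>] strat_space_le_1[OF \<pi>]
    by (intro vertex_dir_in) auto
  then have "v i ?\<pi>' - v i \<pi> \<le> (\<Sum>m\<in>A i. g i \<pi> $ (i, m) * (?\<pi>' $ (i, m) - \<pi> $ (i, m)))"
    using \<pi> by (intro block_concave) (auto simp: vertex_dir_nth)
  also have "\<dots> = t * (\<Sum>m\<in>A i. g i \<pi> $ (i, m) * vertex_dir i j \<pi> $ (i, m))"
    by (simp add: sum_distrib_left mult_ac)
  also have "(\<Sum>m\<in>A i. g i \<pi> $ (i, m) * vertex_dir i j \<pi> $ (i, m)) = g i \<pi> \<bullet> vertex_dir i j \<pi>"
    using strat_spaceD(3)[OF \<pi>] j by (intro inner_block[symmetric]) (auto simp: vertex_dir_nth)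
  finally show ?thesis using t \<pi> j by (simp add: inner_vertex_dir field_simps)
qed

lemma advantage_lsc:
  assumes x: "x \<in> X" and j: "j \<in> A i" and y: "y < adv i j x"
  shows "\<exists>\<epsilon>>0. \<forall>\<pi>\<in>X. dist \<pi> x < \<epsilon> \<longrightarrow> y < adv i j \<pi>"
proof -
  have inX: "\<pi> + t *\<^sub>R vertex_dir i j \<pi> \<in> X" if "\<pi> \<in> X" "0 \<le> t" "t \<le> 1" for \<pi> t
    using that j strat_spaceD(1)[OF that(1)] strat_space_le_1[OF that(1)] by (intro vertex_dir_in) auto
  have "((\<lambda>s. v i (x + s *\<^sub>R vertex_dir i j x)) has_derivative
      (\<lambda>h. g i (x + 0 *\<^sub>R vertex_dir i j x) \<bullet> (h *\<^sub>R vertex_dir i j x))) (at 0 within {0..1})"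
    by (rule line_deriv) (use inX x in auto)
  then have "((\<lambda>s. v i (x + s *\<^sub>R vertex_dir i j x)) has_real_derivative adv i j x) (at 0 within {0..1})"
    using inner_vertex_dir[OF x j, of g] by (simp add: has_field_derivative_def mult_commute_abs)
  then have "((\<lambda>t. (v i (x + t *\<^sub>R vertex_dir i j x) - v i x) / t) \<longlongrightarrow> adv i j x) (at 0 within {0..1})"
    by (simp add: has_field_derivative_iff)
  then have "eventually (\<lambda>t. y < (v i (x + t *\<^sub>R vertex_dir i j x) - v i x) / t) (at 0 within {0..1})"
    using y by (rule order_tendstoD)
  then obtain d where d: "d > 0" "\<And>t. t \<in> {0..1} \<Longrightarrow> t \<noteq> 0 \<Longrightarrow> dist t 0 < d \<Longrightarrow> y < (v i (x + t *\<^sub>R vertex_dir i j x) - v i x) / t"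
    unfolding eventually_at by auto
  define t where "t = min (d / 2) 1"
  have t: "0 < t" "t \<le> 1" "y < (v i (x + t *\<^sub>R vertex_dir i j x) - v i x) / t"
    using d by (auto simp: t_def intro!: d(2))
  have "continuous_on X (\<lambda>\<pi>. if fst k = i then (if snd k = j then 1 else 0) - \<pi> $ k else 0)" for k
    by (cases "fst k = i") (auto intro!: continuous_on_diff continuous_on_minus continuous_on_const continuous_on_component continuous_on_id)
  then have "continuous_on X (\<lambda>\<pi>. vertex_dir i j \<pi>)"
    unfolding vertex_dir_def by (rule continuous_on_vec_lambda)
  then have "continuous_on X (\<lambda>\<pi>. (v i (\<pi> + t *\<^sub>R vertex_dir i j \<pi>) - v i \<pi>) / t)"
    using t inX by (intro continuous_intros continuous_v continuous_on_compose2[OF continuous_v]) auto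
  then have "((\<lambda>\<pi>. (v i (\<pi> + t *\<^sub>R vertex_dir i j \<pi>) - v i \<pi>) / t) \<longlongrightarrow> (v i (x + t *\<^sub>R vertex_dir i j x) - v i x) / t) (at x within X)"
    using x by (simp add: continuous_on_def)
  then have "eventually (\<lambda>\<pi>. y < (v i (\<pi> + t *\<^sub>R vertex_dir i j \<pi>) - v i \<pi>) / t) (at x within X)"
    using t(3) by (rule order_tendstoD)
  then obtain \<epsilon> where \<epsilon>: "\<epsilon> > 0" "\<And>\<pi>. \<pi> \<in> X \<Longrightarrow> \<pi> \<noteq> x \<Longrightarrow> dist \<pi> x < \<epsilon> \<Longrightarrow> y < (v i (\<pi> + t *\<^sub>R vertex_dir i j \<pi>) - v i \<pi>) / t"
    unfolding eventually_at by auto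
  have "y < adv i j \<pi>" if "\<pi> \<in> X" "dist \<pi> x < \<epsilon>" for \<pi>
    using \<epsilon>(2)[of \<pi>] that t(3) advantage_lower[OF that(1) j t(1,2)] by (cases "\<pi> = x") auto
  with \<epsilon>(1) show ?thesis by blast
qed

lemma nash_if_advantage_nonpos:
  assumes x: "x \<in> X" and "\<And>i j. j \<in> A i \<Longrightarrow> adv i j x \<le> 0"
  shows "x \<in> nash_equilibria A v"
proof -
  have "v i (block_upd i p x) \<le> v i x" if p: "p \<in> X" for i p
  proof -
    have "v i (block_upd i p x) - v i x \<le> (\<Sum>j\<in>A i. g i x $ (i, j) * (block_upd i p x $ (i, j) - x $ (i, j)))"
      by (rule block_concave) (use x p in \<open>auto simp: block_upd_in block_upd_nth\<close>)
    also have "\<dots> = (\<Sum>j\<in>A i. p $ (i, j) * adv i j x)"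
      by (simp add: block_upd_nth sum_advantage p)
    also have "\<dots> \<le> 0" using assms(2) strat_spaceD(1)[OF p] by (intro sum_nonpos mult_nonneg_nonpos) auto
    finally show ?thesis by simp
  qed
  then show ?thesis using x by (auto simp: nash_equilibria_def)
qed

end

section \<open>Kullback-Leibler divergence\<close>

lemma strat_interiorD:
  assumes "\<sigma> \<in> strat_interior A"
  shows "\<sigma> \<in> strat_space A" "j \<in> A i \<Longrightarrow> 0 < \<sigma> $ (i, j)"
  using assms by (auto simp: strat_interior_def)

lemma KL_diff:
  assumes "\<sigma> \<in> strat_interior A" "\<sigma>' \<in> strat_interior A" "p \<in> strat_space A"
  shows "KL A p \<sigma> - KL A p \<sigma>' = (\<Sum>i\<in>UNIV. \<Sum>j\<in>A i. p $ (i, j) * (ln (\<sigma>' $ (i, j)) - ln (\<sigma> $ (i, j))))"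
proof -
  have "p $ (i, j) * ln (p $ (i, j) / \<sigma> $ (i, j)) - p $ (i, j) * ln (p $ (i, j) / \<sigma>' $ (i, j))
      = p $ (i, j) * (ln (\<sigma>' $ (i, j)) - ln (\<sigma> $ (i, j)))" if "j \<in> A i" for i j
    using strat_interiorD(2)[OF assms(1) that] strat_interiorD(2)[OF assms(2) that] strat_spaceD(1)[OF assms(3), of i j]
    by (cases "p $ (i, j) = 0") (auto simp: ln_div algebra_simps)
  then show ?thesis by (simp add: KL_def sum_subtractf[symmetric])
qed

text \<open>The bound \<open>ln x \<le> x - 1\<close> at \<open>x = sqrt (\<sigma> / p)\<close> compares the divergence with the
  squared Hellinger distance.\<close>
lemma KL_ge_hellinger:
  assumes p: "p \<in> strat_space A" and \<sigma>: "\<sigma> \<in> strat_interior A"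
  shows "(\<Sum>i\<in>UNIV. \<Sum>j\<in>A i. (sqrt (p $ (i, j)) - sqrt (\<sigma> $ (i, j)))\<^sup>2) \<le> KL A p \<sigma>"
proof -
  have *: "2 * x - 2 * sqrt (x * y) \<le> x * ln (x / y)" if "0 \<le> x" "0 < y" for x y :: real
  proof (cases "x = 0")
    case False
    then have x: "x > 0" using that by simp
    have "- ln (x / y) = 2 * ln (sqrt (y / x))" using x that by (simp add: ln_sqrt ln_div)
    also have "\<dots> \<le> 2 * (sqrt (y / x) - 1)" using x that ln_le_minus_one[of "sqrt (y / x)"] by simp
    finally have "x * (- ln (x / y)) \<le> x * (2 * (sqrt (y / x) - 1))" using x by (intro mult_left_mono) auto
    moreover have "x * sqrt (y / x) = sqrt (x * y)"
      using x that by (simp add: real_sqrt_divide real_sqrt_mult) (metis real_div_sqrt mult.commute less_imp_le times_divide_eq_right)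
    ultimately show ?thesis by (simp add: algebra_simps)
  qed simp
  have "(\<Sum>j\<in>A i. (sqrt (p $ (i, j)) - sqrt (\<sigma> $ (i, j)))\<^sup>2) \<le> (\<Sum>j\<in>A i. p $ (i, j) * ln (p $ (i, j) / \<sigma> $ (i, j)))" for i
  proof -
    have "(\<Sum>j\<in>A i. (sqrt (p $ (i, j)) - sqrt (\<sigma> $ (i, j)))\<^sup>2)
       = (\<Sum>j\<in>A i. p $ (i, j) + \<sigma> $ (i, j) - 2 * sqrt (p $ (i, j) * \<sigma> $ (i, j)))"
      using strat_spaceD(1)[OF p] strat_spaceD(1)[OF strat_interiorD(1)[OF \<sigma>]]
      by (intro sum.cong refl) (simp add: power2_diff real_sqrt_mult)
    also have "\<dots> = (\<Sum>j\<in>A i. 2 * p $ (i, j) - 2 * sqrt (p $ (i, j) * \<sigma> $ (i, j)))"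
      using strat_spaceD(2)[OF p] strat_spaceD(2)[OF strat_interiorD(1)[OF \<sigma>]]
      by (simp add: sum_subtractf sum.distrib sum_distrib_left[symmetric])
    also have "\<dots> \<le> (\<Sum>j\<in>A i. p $ (i, j) * ln (p $ (i, j) / \<sigma> $ (i, j)))"
      using strat_spaceD(1)[OF p] strat_interiorD(2)[OF \<sigma>] by (intro sum_mono *) auto
    finally show ?thesis .
  qed
  then show ?thesis unfolding KL_def by (rule sum_mono)
qed

lemma KL_nonneg:
  assumes "p \<in> strat_space A" "\<sigma> \<in> strat_interior A" shows "0 \<le> KL A p \<sigma>"
  by (rule order_trans[OF _ KL_ge_hellinger[OF assms]]) (intro sum_nonneg, simp)

lemma KL_ge_mass:
  assumes p: "p \<in> strat_space A" and \<sigma>: "\<sigma> \<in> strat_interior A"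
    and B: "\<And>i j. (i, j) \<in> B \<Longrightarrow> p $ (i, j) = 0"
  shows "(\<Sum>k\<in>B. \<sigma> $ k) \<le> KL A p \<sigma>"
proof -
  let ?h = "\<lambda>k. (sqrt (p $ k) - sqrt (\<sigma> $ k))\<^sup>2"
  have *: "\<sigma> $ k = ?h k" if "k \<in> B" for k
    using that B[of "fst k" "snd k"] strat_spaceD(1)[OF strat_interiorD(1)[OF \<sigma>], of "fst k" "snd k"] by simp
  have "?h (i, j) = 0" if "j \<notin> A i" for i j
    using that strat_spaceD(3)[OF p] strat_spaceD(3)[OF strat_interiorD(1)[OF \<sigma>]] by simp
  then have "(\<Sum>k\<in>UNIV. ?h k) = (\<Sum>k\<in>Sigma UNIV A. ?h k)" by (intro sum.mono_neutral_right) auto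
  also have "\<dots> \<le> KL A p \<sigma>"
    using KL_ge_hellinger[OF p \<sigma>] by (simp add: sum.Sigma case_prod_unfold)
  finally have "(\<Sum>k\<in>UNIV. ?h k) \<le> KL A p \<sigma>" .
  moreover have "(\<Sum>k\<in>B. ?h k) \<le> (\<Sum>k\<in>UNIV. ?h k)" by (rule sum_mono2) auto
  ultimately show ?thesis using * by simp
qed

lemma KL_small_imp_near:
  fixes p :: "('n::finite, 'a::finite) profile"
  assumes p: "p \<in> strat_space A" and "0 < \<epsilon>"
  shows "\<exists>u>0. \<forall>\<sigma>\<in>strat_interior A. KL A p \<sigma> < u \<longrightarrow> dist \<sigma> p < \<epsilon>"
proof (intro exI[of _ "(\<epsilon> / (2 * real CARD('n \<times> 'a)))\<^sup>2"] conjI ballI impI)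
  define m where "m = real CARD('n \<times> 'a)"
  have m: "m > 0" by (simp add: m_def)
  show "0 < (\<epsilon> / (2 * real CARD('n \<times> 'a)))\<^sup>2" using assms by simp
  fix \<sigma> assume \<sigma>: "\<sigma> \<in> strat_interior A" and lt: "KL A p \<sigma> < (\<epsilon> / (2 * real CARD('n \<times> 'a)))\<^sup>2"
  have \<sigma>': "\<sigma> \<in> strat_space A" by (rule strat_interiorD(1)[OF \<sigma>])
  have *: "\<bar>\<sigma> $ (i, j) - p $ (i, j)\<bar> < \<epsilon> / m" for i j
  proof (cases "j \<in> A i")
    case True
    let ?d = "sqrt (p $ (i, j)) - sqrt (\<sigma> $ (i, j))"
    have "?d\<^sup>2 \<le> (\<Sum>j\<in>A i. (sqrt (p $ (i, j)) - sqrt (\<sigma> $ (i, j)))\<^sup>2)"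
      using True by (intro member_le_sum) auto
    also have "\<dots> \<le> (\<Sum>i\<in>UNIV. \<Sum>j\<in>A i. (sqrt (p $ (i, j)) - sqrt (\<sigma> $ (i, j)))\<^sup>2)"
      by (rule member_le_sum[of i UNIV "\<lambda>i. \<Sum>j\<in>A i. (sqrt (p $ (i, j)) - sqrt (\<sigma> $ (i, j)))\<^sup>2"]) (auto intro: sum_nonneg)
    also note KL_ge_hellinger[OF p \<sigma>]
    finally have "?d\<^sup>2 < (\<epsilon> / (2 * m))\<^sup>2" using lt by (simp add: m_def)
    then have d: "\<bar>?d\<bar> < \<epsilon> / (2 * m)" using assms m by (intro power2_less_imp_less[of "\<bar>?d\<bar>"]) auto
    have "\<sigma> $ (i, j) - p $ (i, j) = - ?d * (sqrt (p $ (i, j)) + sqrt (\<sigma> $ (i, j)))"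
      using strat_spaceD(1)[OF p, of i j] strat_spaceD(1)[OF \<sigma>', of i j] by (simp add: algebra_simps)
    then have "\<bar>\<sigma> $ (i, j) - p $ (i, j)\<bar> = \<bar>?d\<bar> * (sqrt (p $ (i, j)) + sqrt (\<sigma> $ (i, j)))"
      using strat_spaceD(1)[OF p, of i j] strat_spaceD(1)[OF \<sigma>', of i j] by (simp add: abs_mult abs_minus_commute)
    also have "\<dots> \<le> \<bar>?d\<bar> * 2"
      using add_mono[OF real_sqrt_le_mono[OF strat_space_le_1[OF p, of i j]] real_sqrt_le_mono[OF strat_space_le_1[OF \<sigma>', of i j]]]
      by (intro mult_left_mono) auto
    also have "\<dots> < \<epsilon> / m" using d by (simp add: field_simps)
    finally show ?thesis .
  qed (use strat_spaceD(3)[OF p] strat_spaceD(3)[OF \<sigma>'] assms m in simp)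
  have "dist \<sigma> p \<le> (\<Sum>k\<in>UNIV. \<bar>(\<sigma> - p) $ k\<bar>)" unfolding dist_norm by (rule norm_le_l1_cart)
  also have "\<dots> < (\<Sum>k\<in>(UNIV :: ('n \<times> 'a) set). \<epsilon> / m)" by (rule sum_strict_mono) (auto simp: *)
  also have "\<dots> = \<epsilon>" using m by (simp add: m_def)
  finally show "dist \<sigma> p < \<epsilon>" .
qed

lemma KL_tendsto_0:
  assumes p: "p \<in> strat_space A" and int: "\<And>n. x n \<in> strat_interior A" and lim: "x \<longlonglongrightarrow> p"
  shows "(\<lambda>n. KL A p (x n)) \<longlonglongrightarrow> 0"
proof -
  have "(\<lambda>n. p $ (i, j) * ln (p $ (i, j) / x n $ (i, j))) \<longlonglongrightarrow> 0" for i j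
  proof (cases "p $ (i, j) = 0")
    case False
    have "(\<lambda>n. p $ (i, j) * ln (p $ (i, j) / x n $ (i, j))) \<longlonglongrightarrow> p $ (i, j) * ln (p $ (i, j) / p $ (i, j))"
      by (intro tendsto_intros lim) (use False in auto)
    then show ?thesis using False by simp
  qed simp
  then show ?thesis unfolding KL_def by (intro tendsto_null_sum) auto
qed

lemma powr_mean_le:
  fixes a b :: real assumes "0 \<le> a" "0 \<le> b" "0 < \<alpha>" "\<alpha> < 1"
  shows "a powr \<alpha> * b powr (1 - \<alpha>) \<le> \<alpha> * a + (1 - \<alpha>) * b"
proof (cases "a = 0 \<or> b = 0")
  case False
  then show ?thesis using assms by (intro Youngs_inequality_0) auto
qed (use assms in auto)

lemma affinity_le_1:
  assumes "p \<in> strat_space A" "q \<in> strat_space A" "0 < \<alpha>" "\<alpha> < 1"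
  shows "(\<Sum>j\<in>A i. p $ (i, j) powr \<alpha> * q $ (i, j) powr (1 - \<alpha>)) \<le> 1"
proof -
  have "(\<Sum>j\<in>A i. p $ (i, j) powr \<alpha> * q $ (i, j) powr (1 - \<alpha>)) \<le> (\<Sum>j\<in>A i. \<alpha> * p $ (i, j) + (1 - \<alpha>) * q $ (i, j))"
    using assms strat_spaceD(1)[OF assms(1)] strat_spaceD(1)[OF assms(2)] by (intro sum_mono powr_mean_le) auto
  also have "\<dots> = 1"
    using strat_spaceD(2)[OF assms(1)] strat_spaceD(2)[OF assms(2)] by (simp add: sum.distrib sum_distrib_left[symmetric])
  finally show ?thesis .
qed

section \<open>Optimality conditions\<close>

text \<open>The term \<open>t powr \<alpha>\<close> gained by entering the missing coordinate beats the linear loss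
  in the payoff.\<close>
lemma (in monotone_game) maximizer_interior:
  assumes \<sigma>: "\<sigma> \<in> strat_interior A" and x: "x \<in> X" and \<alpha>: "0 < \<alpha>" "\<alpha> < 1" and \<kappa>: "0 < \<kappa>" and j: "j \<in> A i"
    and S_def: "S = (\<lambda>p. \<Sum>l\<in>A i. p $ (i, l) powr \<alpha> * \<sigma> $ (i, l) powr (1 - \<alpha>))"
    and opt: "\<And>p. p \<in> X \<Longrightarrow> S x \<le> S p \<Longrightarrow> v i (block_upd i p x) - v i x \<le> - \<kappa> * (S p - S x)"
  shows "0 < x $ (i, j)"
proof (rule ccontr)
  assume "\<not> ?thesis"
  then have x0: "x $ (i, j) = 0" using strat_spaceD(1)[OF x, of i j] by simp
  have \<sigma>X: "\<sigma> \<in> X" by (rule strat_interiorD(1)[OF \<sigma>])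
  have \<sigma>j: "0 < \<sigma> $ (i, j)" using strat_interiorD(2)[OF \<sigma> j] .
  define d where "d = block_upd i \<sigma> x - x"
  define p where "p t = x + t *\<^sub>R (\<sigma> - x)" for t
  have pX: "p t \<in> X" if "t \<in> {0..1}" for t
    using convexD_alt[OF convex_strat_space x \<sigma>X, of t] that by (simp add: p_def algebra_simps)
  have upd: "block_upd i (p t) x = x + t *\<^sub>R d" for t
    by (simp add: vec_eq_iff d_def p_def block_upd_def)
  have seg: "x + t *\<^sub>R d \<in> X" if "t \<in> {0..1}" for t
    using block_upd_in[OF pX[OF that] x, of i] by (simp add: upd)
  define L where "L = g i x \<bullet> d"
  have "((\<lambda>t. v i (x + t *\<^sub>R d)) has_derivative (\<lambda>h. g i (x + 0 *\<^sub>R d) \<bullet> (h *\<^sub>R d))) (at 0 within {0..1})"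
    by (rule line_deriv) (use seg in auto)
  then have "((\<lambda>t. (v i (x + t *\<^sub>R d) - v i x) / t) \<longlongrightarrow> L) (at_right 0)"
    by (simp add: has_field_derivative_def[symmetric] has_field_derivative_iff L_def mult_commute_abs at_within_Icc_at_right)
  then have ev1: "eventually (\<lambda>t. L - 1 < (v i (x + t *\<^sub>R d) - v i x) / t) (at_right 0)"
    by (rule order_tendstoD) simp
  define Q where "Q = \<bar>L - 1\<bar> + \<kappa>"
  have Q: "Q > 0" using \<kappa> by (simp add: Q_def)
  have "((\<lambda>t :: real. t powr (1 - \<alpha>)) \<longlongrightarrow> 0) (at_right 0)"
    by (rule tendsto_zero_powrI[where b = "1 - \<alpha>"])
       (use \<alpha> in \<open>auto intro!: tendsto_eq_intros simp: eventually_at_right_less eventually_at_filter\<close>)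
  then have ev2: "eventually (\<lambda>t. t powr (1 - \<alpha>) < min (\<sigma> $ (i, j)) (\<kappa> * \<sigma> $ (i, j) / Q)) (at_right (0 :: real))"
    by (rule order_tendstoD) (use \<sigma>j \<kappa> Q in auto)
  have ev3: "eventually (\<lambda>t. 0 < t \<and> t < 1) (at_right (0 :: real))"
    by (auto simp: eventually_at_right_field intro: exI[of _ 1])
  obtain t where t: "0 < t" "t < 1" and t1: "L - 1 < (v i (x + t *\<^sub>R d) - v i x) / t"
    and t2: "t powr (1 - \<alpha>) < \<sigma> $ (i, j)" "t powr (1 - \<alpha>) < \<kappa> * \<sigma> $ (i, j) / Q"
    using eventually_happens[OF eventually_conj[OF ev1 eventually_conj[OF ev2 ev3]]] by auto
  define q where "q = t powr \<alpha>"
  have tq: "t = q * t powr (1 - \<alpha>)" "q > 0" using t by (auto simp: q_def powr_add[symmetric])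
  let ?f = "\<lambda>y l. y $ (i, l) powr \<alpha> * \<sigma> $ (i, l) powr (1 - \<alpha>)"
  have S_ge: "(1 - t) * S x + q * \<sigma> $ (i, j) \<le> S (p t)"
  proof -
    have "(1 - t) * ?f x l + (if l = j then q * \<sigma> $ (i, j) else 0) \<le> ?f (p t) l" for l
    proof (cases "l = j")
      case True
      have "(t * \<sigma> $ (i, j)) powr \<alpha> * \<sigma> $ (i, j) powr (1 - \<alpha>) = q * \<sigma> $ (i, j)"
        using t \<sigma>j by (simp add: powr_mult q_def mult.assoc powr_add[symmetric])
      then show ?thesis using True x0 by (simp add: p_def)
    next
      case False
      have "(1 - t) * x $ (i, l) powr \<alpha> \<le> (1 - t) powr \<alpha> * x $ (i, l) powr \<alpha>"
        using t \<alpha> powr_mono'[of \<alpha> 1 "1 - t"] by (intro mult_right_mono) auto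
      also have "\<dots> = ((1 - t) * x $ (i, l)) powr \<alpha>"
        using t strat_spaceD(1)[OF x] by (simp add: powr_mult)
      also have "\<dots> \<le> (p t $ (i, l)) powr \<alpha>"
        using t \<alpha> strat_spaceD(1)[OF x, of i l] strat_spaceD(1)[OF \<sigma>X, of i l]
        by (intro powr_mono2) (auto simp: p_def algebra_simps mult_left_le_one_le)
      finally have "(1 - t) * x $ (i, l) powr \<alpha> * \<sigma> $ (i, l) powr (1 - \<alpha>) \<le> ?f (p t) l"
        by (intro mult_right_mono) auto
      then show ?thesis using False by (simp add: mult.assoc)
    qed
    then have "(\<Sum>l\<in>A i. (1 - t) * ?f x l + (if l = j then q * \<sigma> $ (i, j) else 0)) \<le> S (p t)"
      unfolding S_def by (intro sum_mono)
    moreover have "(\<Sum>l\<in>A i. (1 - t) * ?f x l + (if l = j then q * \<sigma> $ (i, j) else 0)) = (1 - t) * S x + q * \<sigma> $ (i, j)"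
      using j by (simp add: sum.distrib sum_distrib_left S_def)
    ultimately show ?thesis by simp
  qed
  have S1: "S x \<le> 1" unfolding S_def by (rule affinity_le_1[OF x \<sigma>X \<alpha>])
  have "t * S x \<le> t" using mult_left_le[OF S1, of t] t by simp
  then have gain: "q * \<sigma> $ (i, j) - t \<le> S (p t) - S x"
    using S_ge unfolding left_diff_distrib by linarith
  have "t < q * \<sigma> $ (i, j)" using t2(1) tq mult_strict_left_mono[OF t2(1) tq(2)] by simp
  then have "S x \<le> S (p t)" using gain by simp
  from opt[OF pX this] t have "v i (x + t *\<^sub>R d) - v i x \<le> - \<kappa> * (S (p t) - S x)" by (simp add: upd)
  also have "\<dots> \<le> - \<kappa> * (q * \<sigma> $ (i, j) - t)" using mult_left_mono[OF gain, of \<kappa>] \<kappa> by simp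
  finally have "(L - 1) * t < - \<kappa> * (q * \<sigma> $ (i, j) - t)" using t1 t by (simp add: field_simps)
  then have "\<kappa> * \<sigma> $ (i, j) * q < (\<kappa> - (L - 1)) * t" by (simp add: algebra_simps)
  also have "\<dots> \<le> Q * t" using t by (intro mult_right_mono) (auto simp: Q_def)
  also have "\<dots> = Q * t powr (1 - \<alpha>) * q" by (subst tq(1)) simp
  also have "\<dots> < \<kappa> * \<sigma> $ (i, j) * q" using t2(2) Q tq(2) by (intro mult_strict_right_mono) (simp_all add: field_simps)
  finally show False .
qed

lemma (in monotone_game) first_order:
  assumes x: "x \<in> strat_interior A" and j: "j \<in> A i"
    and opt: "perturbed_eq A v G \<mu> \<sigma> x"
    and H: "\<And>t. \<bar>t\<bar> < x $ (i, j) \<Longrightarrow> x + t *\<^sub>R vertex_dir i j x \<in> strat_interior A \<Longrightarrow>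
       G (A i) (block (x + t *\<^sub>R vertex_dir i j x) i) (block \<sigma> i) = ereal (H t)"
    and H': "(H has_real_derivative H') (at 0)"
  shows "adv i j x = \<mu> * H'"
proof -
  define e where "e = x $ (i, j)"
  have xX: "x \<in> X" by (rule strat_interiorD(1)[OF x])
  have e: "0 < e" "e \<le> 1" using strat_interiorD(2)[OF x j] strat_space_le_1[OF xX] by (auto simp: e_def)
  let ?y = "\<lambda>t. x + t *\<^sub>R vertex_dir i j x"
  have y_pos: "0 < e + t * (1 - e)" if "\<bar>t\<bar> < e" for t
  proof (cases "t \<ge> 0")
    case False
    then have "t * 1 \<le> t * (1 - e)" using e by (intro mult_left_mono_neg) auto
    then show ?thesis using that by simp
  next
    case True
    then have "0 \<le> t * (1 - e)" using e by simp
    then show ?thesis using e by linarith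
  qed
  have inX: "?y t \<in> X" if "\<bar>t\<bar> < e" for t
    using that e y_pos[OF that] xX j by (intro vertex_dir_in) (auto simp: e_def)
  have int: "?y t \<in> strat_interior A" if "\<bar>t\<bar> < e" for t
  proof -
    have "0 < x $ (l, m) + t * vertex_dir i j x $ (l, m)" if m: "m \<in> A l" for l m
    proof -
      have "0 < (1 - t) * x $ (l, m)" using strat_interiorD(2)[OF x m] \<open>\<bar>t\<bar> < e\<close> e by simp
      then show ?thesis using strat_interiorD(2)[OF x m] y_pos[OF \<open>\<bar>t\<bar> < e\<close>]
        by (auto simp: vertex_dir_nth e_def algebra_simps)
    qed
    then show ?thesis using inX[OF that] by (simp add: strat_interior_def)
  qed
  have upd: "block_upd i (?y t) x = ?y t" for t
    by (simp add: vec_eq_iff block_upd_def vertex_dir_def)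
  have G: "G (A i) (block (?y t) i) (block \<sigma> i) = ereal (H t)" if "\<bar>t\<bar> < e" for t
    using H[of t] int[OF that] that by (simp add: e_def)
  have "ereal (v i (?y t)) - ereal \<mu> * ereal (H t) \<le> ereal (v i (?y 0)) - ereal \<mu> * ereal (H 0)"
    if "\<bar>t\<bar> < e" for t
  proof -
    have "ereal (v i (block_upd i (?y t) x)) - ereal \<mu> * G (A i) (block (?y t) i) (block \<sigma> i)
        \<le> ereal (v i x) - ereal \<mu> * G (A i) (block x i) (block \<sigma> i)"
      using opt inX[OF that] by (simp add: perturbed_eq_def)
    then show ?thesis using G[of 0] e by (simp add: upd G[OF that])
  qed
  then have max: "v i (?y t) - \<mu> * H t \<le> v i (?y 0) - \<mu> * H 0" if "\<bar>t\<bar> < e" for t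
    using that by simp
  have "((\<lambda>t. v i (?y t)) has_derivative (\<lambda>h. g i (?y 0) \<bullet> (h *\<^sub>R vertex_dir i j x))) (at 0 within {-e<..<e})"
    using inX e by (intro line_deriv) auto
  then have "((\<lambda>t. v i (?y t)) has_real_derivative adv i j x) (at 0 within {-e<..<e})"
    using inner_vertex_dir[OF xX j, of g] by (simp add: has_field_derivative_def mult_commute_abs)
  then have "((\<lambda>t. v i (?y t)) has_real_derivative adv i j x) (at 0)"
    using e by (simp add: at_within_open[of 0 "{-e<..<e}"])
  then have "((\<lambda>t. v i (?y t) - \<mu> * H t) has_real_derivative adv i j x - \<mu> * H') (at 0)"
    by (auto intro!: derivative_eq_intros H')
  then have "adv i j x - \<mu> * H' = 0"
    by (rule DERIV_local_max[OF _ e(1)]) (use max in auto)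
  then show ?thesis by simp
qed

lemma affinity_deriv:
  fixes x \<sigma> :: "('n::finite, 'a::finite) profile" and \<alpha> :: real
  assumes x: "x \<in> strat_interior A" and \<sigma>: "\<sigma> \<in> strat_interior A" and j: "j \<in> A i"
  defines "S \<equiv> \<Sum>l\<in>A i. x $ (i, l) powr \<alpha> * \<sigma> $ (i, l) powr (1 - \<alpha>)"
  shows "((\<lambda>t. \<Sum>l\<in>A i. (x + t *\<^sub>R vertex_dir i j x) $ (i, l) powr \<alpha> * \<sigma> $ (i, l) powr (1 - \<alpha>))
    has_real_derivative \<alpha> * ((\<sigma> $ (i, j) / x $ (i, j)) powr (1 - \<alpha>) - S)) (at 0)"
proof -
  let ?r = "\<lambda>l. (\<sigma> $ (i, l) / x $ (i, l)) powr (1 - \<alpha>)"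
  let ?d = "\<lambda>l. vertex_dir i j x $ (i, l)"
  have r: "x $ (i, l) powr (\<alpha> - 1) * \<sigma> $ (i, l) powr (1 - \<alpha>) = ?r l" if "l \<in> A i" for l
    using strat_interiorD(2)[OF x that] strat_interiorD(2)[OF \<sigma> that]
      powr_minus_divide[of "x $ (i, l)" "1 - \<alpha>"]
    by (simp add: powr_divide)
  have S: "S = (\<Sum>l\<in>A i. x $ (i, l) * ?r l)"
    unfolding S_def
  proof (intro sum.cong refl)
    fix l assume l: "l \<in> A i"
    have "x $ (i, l) powr \<alpha> = x $ (i, l) powr 1 * x $ (i, l) powr (\<alpha> - 1)"
      using strat_interiorD(2)[OF x l] by (simp only: powr_add[symmetric]) simp
    then show "x $ (i, l) powr \<alpha> * \<sigma> $ (i, l) powr (1 - \<alpha>) = x $ (i, l) * ?r l"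
      using r[OF l] strat_interiorD(2)[OF x l] by (simp add: mult.assoc)
  qed
  have "((\<lambda>t. \<Sum>l\<in>A i. (x $ (i, l) + t * ?d l) powr \<alpha> * \<sigma> $ (i, l) powr (1 - \<alpha>))
    has_real_derivative (\<Sum>l\<in>A i. \<alpha> * ?d l * (x $ (i, l) powr (\<alpha> - 1) * \<sigma> $ (i, l) powr (1 - \<alpha>)))) (at 0)"
    using strat_interiorD(2)[OF x] by (intro DERIV_sum) (auto intro!: derivative_eq_intros)
  moreover have "(\<Sum>l\<in>A i. \<alpha> * ?d l * (x $ (i, l) powr (\<alpha> - 1) * \<sigma> $ (i, l) powr (1 - \<alpha>)))
     = \<alpha> * ((\<sigma> $ (i, j) / x $ (i, j)) powr (1 - \<alpha>) - S)"
  proof -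
    have "(\<Sum>l\<in>A i. \<alpha> * ?d l * (x $ (i, l) powr (\<alpha> - 1) * \<sigma> $ (i, l) powr (1 - \<alpha>)))
        = \<alpha> * (\<Sum>l\<in>A i. ?d l * ?r l)"
      unfolding sum_distrib_left by (intro sum.cong refl) (simp add: r mult.assoc)
    also have "(\<Sum>l\<in>A i. ?d l * ?r l) = (\<Sum>l\<in>A i. (if l = j then ?r l else 0) - x $ (i, l) * ?r l)"
      by (intro sum.cong refl) (simp add: vertex_dir_nth algebra_simps)
    also have "\<dots> = ?r j - S" using j by (simp add: sum_subtractf S)
    finally show ?thesis .
  qed
  ultimately show ?thesis by simp
qed

text \<open>All three divergences lead to the same first-order condition; the normalising factors
  \<open>s\<close> and \<open>t\<close> are \<open>(S, 1)\<close> for the alpha-divergence, \<open>(1, S)\<close> for the Renyi divergence and \<open>(1, 1)\<close>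
  for the reverse KL divergence, where \<open>S\<close> is the sum over \<open>j\<close> of
  \<open>x j powr \<alpha> * \<sigma> j powr (1 - \<alpha>)\<close>.\<close>
definition (in monotone_game) prox_step :: "real \<Rightarrow> real \<Rightarrow> ('n,'a) profile \<Rightarrow> ('n,'a) profile \<Rightarrow> ('n \<Rightarrow> real) \<Rightarrow> ('n \<Rightarrow> real) \<Rightarrow> bool" where
  "prox_step c \<beta> \<sigma> x s t \<longleftrightarrow> x \<in> strat_interior A \<and>
     (\<forall>i. 0 < s i \<and> s i \<le> 1 \<and> 0 < t i \<and> t i \<le> 1 \<and>
       (\<forall>j\<in>A i. adv i j x = c * (s i - (\<sigma> $ (i, j) / x $ (i, j)) powr \<beta> / t i)))"

lemma block_apply: "block p i j = p $ (i, j)"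
  by (simp add: block_def)

lemma affinity_pos:
  assumes "x \<in> strat_interior A" "\<sigma> \<in> strat_interior A" "A i \<noteq> {}"
  shows "0 < (\<Sum>l\<in>A i. x $ (i, l) powr \<alpha> * \<sigma> $ (i, l) powr (1 - \<alpha>))"
  using assms strat_interiorD(2)[OF assms(1)] strat_interiorD(2)[OF assms(2)]
  by (intro sum_pos) (auto intro!: mult_pos_pos simp: less_imp_neq[symmetric])

lemma affinity_self:
  assumes "\<sigma> \<in> strat_space A"
  shows "(\<Sum>l\<in>A i. \<sigma> $ (i, l) powr \<alpha> * \<sigma> $ (i, l) powr (1 - \<alpha>)) = 1"
proof -
  have "(\<Sum>l\<in>A i. \<sigma> $ (i, l) powr \<alpha> * \<sigma> $ (i, l) powr (1 - \<alpha>)) = (\<Sum>l\<in>A i. \<sigma> $ (i, l))"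
    using strat_spaceD(1)[OF assms] by (intro sum.cong refl) (simp add: powr_add[symmetric])
  then show ?thesis using strat_spaceD(2)[OF assms] by simp
qed

context monotone_game
begin

lemma perturbed_eqD:
  assumes "perturbed_eq A v G \<mu> \<sigma> x"
  shows "x \<in> X" "p \<in> X \<Longrightarrow> ereal (v i (block_upd i p x)) - ereal \<mu> * G (A i) (block p i) (block \<sigma> i)
        \<le> ereal (v i x) - ereal \<mu> * G (A i) (block x i) (block \<sigma> i)"
  using assms by (auto simp: perturbed_eq_def)

lemma prox_step_alpha:
  assumes \<alpha>: "0 < \<alpha>" "\<alpha> < 1" and \<mu>: "0 < \<mu>" and \<sigma>: "\<sigma> \<in> strat_interior A"
    and opt: "perturbed_eq A v (alpha_div \<alpha>) \<mu> \<sigma> x"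
  shows "\<exists>s t. prox_step (\<mu> / (1 - \<alpha>)) (1 - \<alpha>) \<sigma> x s t"
proof -
  define S where "S i p = (\<Sum>l\<in>A i. p $ (i, l) powr \<alpha> * \<sigma> $ (i, l) powr (1 - \<alpha>))" for i p
  have G: "alpha_div \<alpha> (A i) (block p i) (block \<sigma> i) = ereal (1 / (\<alpha> * (1 - \<alpha>)) * (1 - S i p))" for p i
    by (simp add: alpha_div_def S_def block_apply)
  note D = perturbed_eqD[OF opt]
  have pos: "0 < x $ (i, j)" if j: "j \<in> A i" for i j
  proof (rule maximizer_interior[OF \<sigma> D(1) \<alpha> _ j])
    show "S i = (\<lambda>p. \<Sum>l\<in>A i. p $ (i, l) powr \<alpha> * \<sigma> $ (i, l) powr (1 - \<alpha>))" by (simp add: S_def fun_eq_iff)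
    show "0 < \<mu> / (\<alpha> * (1 - \<alpha>))" using \<alpha> \<mu> by simp
    show "v i (block_upd i p x) - v i x \<le> - (\<mu> / (\<alpha> * (1 - \<alpha>))) * (S i p - S i x)" if "p \<in> X" for p
      using D(2)[OF that, of i] by (simp add: G algebra_simps diff_divide_distrib)
  qed
  then have int: "x \<in> strat_interior A" using D(1) by (simp add: strat_interior_def)
  have "adv i j x = \<mu> / (1 - \<alpha>) * (S i x - (\<sigma> $ (i, j) / x $ (i, j)) powr (1 - \<alpha>))" if j: "j \<in> A i" for i j
  proof -
    have "((\<lambda>t. 1 / (\<alpha> * (1 - \<alpha>)) * (1 - S i (x + t *\<^sub>R vertex_dir i j x))) has_real_derivative
       1 / (\<alpha> * (1 - \<alpha>)) * (0 - \<alpha> * ((\<sigma> $ (i, j) / x $ (i, j)) powr (1 - \<alpha>) - S i x))) (at 0)"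
      unfolding S_def by (intro DERIV_cmult DERIV_diff DERIV_const affinity_deriv[OF int \<sigma> j])
    from first_order[OF int j opt G this] show ?thesis using \<alpha> by simp (simp add: algebra_simps diff_divide_distrib)
  qed
  then have "prox_step (\<mu> / (1 - \<alpha>)) (1 - \<alpha>) \<sigma> x (\<lambda>i. S i x) (\<lambda>i. 1)"
    using int affinity_pos[OF int \<sigma> A_ne, of _ \<alpha>] affinity_le_1[OF D(1) strat_interiorD(1)[OF \<sigma>] \<alpha>]
    by (simp add: prox_step_def S_def)
  then show ?thesis by blast
qed

lemma prox_step_renyi:
  assumes \<alpha>: "0 < \<alpha>" "\<alpha> < 1" and \<mu>: "0 < \<mu>" and \<sigma>: "\<sigma> \<in> strat_interior A"
    and opt: "perturbed_eq A v (renyi_div \<alpha>) \<mu> \<sigma> x"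
  shows "\<exists>s t. prox_step (\<mu> * \<alpha> / (1 - \<alpha>)) (1 - \<alpha>) \<sigma> x s t"
proof -
  define S where "S i p = (\<Sum>l\<in>A i. p $ (i, l) powr \<alpha> * \<sigma> $ (i, l) powr (1 - \<alpha>))" for i p
  have G: "renyi_div \<alpha> (A i) (block p i) (block \<sigma> i) = (if S i p = 0 then \<infinity> else ereal (1 / (\<alpha> - 1) * ln (S i p)))" for p i
    by (simp add: renyi_div_def S_def block_apply Let_def)
  note D = perturbed_eqD[OF opt]
  have \<sigma>X: "\<sigma> \<in> X" by (rule strat_interiorD(1)[OF \<sigma>])
  have S_nonneg: "0 \<le> S i p" for i p unfolding S_def by (intro sum_nonneg) auto
  have S_x: "0 < S i x" for i
  proof -
    have "S i x \<noteq> 0"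
      using D(2)[OF \<sigma>X, of i] \<mu> by (auto simp: G affinity_self[OF \<sigma>X] S_def[of i \<sigma>])
    then show ?thesis using S_nonneg[of i x] by simp
  qed
  have pos: "0 < x $ (i, j)" if j: "j \<in> A i" for i j
  proof (rule maximizer_interior[OF \<sigma> D(1) \<alpha> _ j])
    show "S i = (\<lambda>p. \<Sum>l\<in>A i. p $ (i, l) powr \<alpha> * \<sigma> $ (i, l) powr (1 - \<alpha>))" by (simp add: S_def fun_eq_iff)
    show "0 < \<mu> / (1 - \<alpha>)" using \<alpha> \<mu> by simp
    show "v i (block_upd i p x) - v i x \<le> - (\<mu> / (1 - \<alpha>)) * (S i p - S i x)" if p: "p \<in> X" and le: "S i x \<le> S i p" for p
    proof -
      have Sp: "0 < S i p" "S i p \<le> 1" using le S_x[of i] affinity_le_1[OF p \<sigma>X \<alpha>, of i] by (auto simp: S_def)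
      have "ln (S i x / S i p) \<le> S i x / S i p - 1" using Sp S_x[of i] by (intro ln_le_minus_one) auto
      then have "S i p - S i x \<le> (ln (S i p) - ln (S i x)) * S i p" using Sp S_x[of i] by (simp add: ln_div field_simps)
      also have "\<dots> \<le> (ln (S i p) - ln (S i x)) * 1"
        using Sp S_x[of i] le by (intro mult_left_mono) auto
      finally have "\<mu> / (1 - \<alpha>) * (S i p - S i x) \<le> \<mu> / (1 - \<alpha>) * (ln (S i p) - ln (S i x))"
        using \<alpha> \<mu> by (intro mult_left_mono) auto
      moreover have "v i (block_upd i p x) - \<mu> * (1 / (\<alpha> - 1) * ln (S i p)) \<le> v i x - \<mu> * (1 / (\<alpha> - 1) * ln (S i x))"
        using D(2)[OF p, of i] Sp S_x[of i] by (simp add: G)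
      moreover have "1 / (\<alpha> - 1) = - (1 / (1 - \<alpha>))" using \<alpha> by (simp add: field_simps)
      ultimately show ?thesis by (simp add: algebra_simps diff_divide_distrib)
    qed
  qed
  then have int: "x \<in> strat_interior A" using D(1) by (simp add: strat_interior_def)
  have "adv i j x = \<mu> * \<alpha> / (1 - \<alpha>) * (1 - (\<sigma> $ (i, j) / x $ (i, j)) powr (1 - \<alpha>) / S i x)" if j: "j \<in> A i" for i j
  proof -
    have "((\<lambda>t. S i (x + t *\<^sub>R vertex_dir i j x)) has_real_derivative
       \<alpha> * ((\<sigma> $ (i, j) / x $ (i, j)) powr (1 - \<alpha>) - S i x)) (at 0)"
      unfolding S_def by (rule affinity_deriv[OF int \<sigma> j])
    then have "((\<lambda>t. 1 / (\<alpha> - 1) * ln (S i (x + t *\<^sub>R vertex_dir i j x))) has_real_derivative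
       1 / (\<alpha> - 1) * (1 / S i x * (\<alpha> * ((\<sigma> $ (i, j) / x $ (i, j)) powr (1 - \<alpha>) - S i x)))) (at 0)"
      using S_x[of i] by (intro DERIV_cmult) (auto intro!: derivative_eq_intros)
    moreover have "S i y \<noteq> 0" if "y \<in> strat_interior A" for y
      using affinity_pos[OF that \<sigma> A_ne, of i \<alpha>] by (simp add: S_def)
    ultimately have "adv i j x = \<mu> * (1 / (\<alpha> - 1) * (1 / S i x * (\<alpha> * ((\<sigma> $ (i, j) / x $ (i, j)) powr (1 - \<alpha>) - S i x))))"
      by (intro first_order[OF int j opt]) (simp_all add: G)
    also have "\<dots> = \<mu> * \<alpha> / (1 - \<alpha>) * (1 - (\<sigma> $ (i, j) / x $ (i, j)) powr (1 - \<alpha>) / S i x)"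
    proof -
      have "\<mu> * (1 / (\<alpha> - 1) * (1 / S * (\<alpha> * (R - S)))) = \<mu> * \<alpha> / (1 - \<alpha>) * (1 - R / S)" if "0 < S" for R S
        using that \<alpha> by (simp add: divide_simps) (simp add: algebra_simps)
      then show ?thesis using S_x by blast
    qed
    finally show ?thesis .
  qed
  then have "prox_step (\<mu> * \<alpha> / (1 - \<alpha>)) (1 - \<alpha>) \<sigma> x (\<lambda>i. 1) (\<lambda>i. S i x)"
    using int S_x affinity_le_1[OF D(1) \<sigma>X \<alpha>] by (simp add: prox_step_def S_def)
  then show ?thesis by blast
qed

lemma prox_step_rev_KL:
  assumes \<mu>: "0 < \<mu>" and \<sigma>: "\<sigma> \<in> strat_interior A"
    and opt: "perturbed_eq A v rev_KL \<mu> \<sigma> x"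
  shows "\<exists>s t. prox_step \<mu> 1 \<sigma> x s t"
proof -
  note D = perturbed_eqD[OF opt]
  have \<sigma>X: "\<sigma> \<in> X" by (rule strat_interiorD(1)[OF \<sigma>])
  have G: "rev_KL (A i) (block p i) (block \<sigma> i) = ereal (\<Sum>l\<in>A i. \<sigma> $ (i, l) * ln (\<sigma> $ (i, l) / p $ (i, l)))"
    if "p \<in> strat_interior A" for p i
    using strat_interiorD(2)[OF that] by (fastforce simp: rev_KL_def block_apply)
  have pos: "0 < x $ (i, j)" if j: "j \<in> A i" for i j
  proof (rule ccontr)
    assume "\<not> ?thesis"
    then have "x $ (i, j) = 0" using strat_spaceD(1)[OF D(1), of i j] by simp
    then have "rev_KL (A i) (block x i) (block \<sigma> i) = \<infinity>"
      using j strat_interiorD(2)[OF \<sigma> j] by (auto simp: rev_KL_def block_apply)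
    then show False using D(2)[OF \<sigma>X, of i] G[OF \<sigma>, of i] \<mu> by simp
  qed
  then have int: "x \<in> strat_interior A" using D(1) by (simp add: strat_interior_def)
  have "adv i j x = \<mu> * (1 - (\<sigma> $ (i, j) / x $ (i, j)))" if j: "j \<in> A i" for i j
  proof -
    let ?d = "\<lambda>l. vertex_dir i j x $ (i, l)"
    have nz: "x $ (i, l) \<noteq> 0" if "l \<in> A i" for l using strat_interiorD(2)[OF int that] by simp
    have "((\<lambda>t. \<Sum>l\<in>A i. \<sigma> $ (i, l) * ln (\<sigma> $ (i, l) / (x + t *\<^sub>R vertex_dir i j x) $ (i, l))) has_real_derivative
       (\<Sum>l\<in>A i. \<sigma> $ (i, l) * (- ?d l / x $ (i, l)))) (at 0)"
      using strat_interiorD(2)[OF int] strat_interiorD(2)[OF \<sigma>]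
      by (intro DERIV_sum) (auto intro!: derivative_eq_intros simp: field_simps power2_eq_square nz)
    from first_order[OF int j opt G[of _ i] this]
    have "adv i j x = \<mu> * (\<Sum>l\<in>A i. \<sigma> $ (i, l) * (- ?d l / x $ (i, l)))" by simp
    also have "(\<Sum>l\<in>A i. \<sigma> $ (i, l) * (- ?d l / x $ (i, l))) = (\<Sum>l\<in>A i. \<sigma> $ (i, l) - (if l = j then \<sigma> $ (i, l) / x $ (i, l) else 0))"
      using nz by (intro sum.cong refl) (auto simp: vertex_dir_nth field_simps)
    also have "\<dots> = 1 - \<sigma> $ (i, j) / x $ (i, j)"
      using j strat_spaceD(2)[OF \<sigma>X] by (simp add: sum_subtractf)
    finally show ?thesis .
  qed
  then have "prox_step \<mu> 1 \<sigma> x (\<lambda>i. 1) (\<lambda>i. 1)"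
    using int strat_interiorD(2)[OF int] strat_interiorD(2)[OF \<sigma>] by (simp add: prox_step_def less_imp_le)
  then show ?thesis by blast
qed

lemma perturbed_eq_prox_step:
  assumes G_choice: "(\<exists>\<alpha>. 0 < \<alpha> \<and> \<alpha> < 1 \<and> G = alpha_div \<alpha>)
                 \<or> (\<exists>\<alpha>. 0 < \<alpha> \<and> \<alpha> < 1 \<and> G = renyi_div \<alpha>)
                 \<or> G = rev_KL"
    and \<mu>: "0 < \<mu>"
  shows "\<exists>c \<beta>. 0 < c \<and> 0 < \<beta> \<and> (\<forall>\<sigma>\<in>strat_interior A. \<forall>x. perturbed_eq A v G \<mu> \<sigma> x \<longrightarrow> (\<exists>s t. prox_step c \<beta> \<sigma> x s t))"
  using G_choice
proof (elim disjE exE conjE)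
  fix \<alpha> :: real assume \<alpha>: "0 < \<alpha>" "\<alpha> < 1"
  {
    assume "G = alpha_div \<alpha>"
    then show ?thesis using \<alpha> \<mu> prox_step_alpha[OF \<alpha> \<mu>]
      by (intro exI[of _ "\<mu> / (1 - \<alpha>)"] exI[of _ "1 - \<alpha>"]) auto
  next
    assume "G = renyi_div \<alpha>"
    then show ?thesis using \<alpha> \<mu> prox_step_renyi[OF \<alpha> \<mu>]
      by (intro exI[of _ "\<mu> * \<alpha> / (1 - \<alpha>)"] exI[of _ "1 - \<alpha>"]) auto
  }
next
  assume "G = rev_KL"
  then show ?thesis using \<mu> prox_step_rev_KL[OF \<mu>]
    by (intro exI[of _ \<mu>] exI[of _ 1]) auto
qed

end

section \<open>Convergence\<close>

text \<open>Suppose \<open>K\<close> climbs from almost \<open>0\<close> to \<open>u / 2\<close>. Meanwhile \<open>b\<close> grows geometrically, so the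
  climb is bounded by a multiple of the current value of \<open>b\<close>, and \<open>m\<close> steps before its end it was
  at most a multiple of \<open>\<theta> ^ m\<close>. This contradicts the fact that \<open>K\<close> hardly moves in \<open>m\<close> steps.\<close>
lemma escape_contradiction:
  fixes K b :: "nat \<Rightarrow> real"
  assumes small_steps: "(\<lambda>k. K (Suc k) - K k) \<longlonglongrightarrow> 0"
    and incr: "\<And>k. K (Suc k) \<le> K k + C * b (Suc k)"
    and grow: "\<And>k. K (Suc k) < u \<Longrightarrow> b k \<le> \<theta> * b (Suc k)"
    and inf0: "\<And>\<epsilon> N. 0 < \<epsilon> \<Longrightarrow> \<exists>k\<ge>N. K k < \<epsilon>"
    and b_pos: "\<And>k. 0 < b k" and b_le: "\<And>k. b k \<le> K k"
    and u: "0 < u" and \<theta>: "0 < \<theta>" "\<theta> < 1" and C: "0 \<le> C"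
  shows False
proof -
  define C' where "C' = C / (1 - \<theta>)"
  have C': "0 \<le> C'" "C = C' * (1 - \<theta>)" using \<theta> C by (auto simp: C'_def)
  have "(\<lambda>m. C' * \<theta> ^ m) \<longlonglongrightarrow> C' * 0"
    by (intro tendsto_mult tendsto_const LIMSEQ_realpow_zero) (use \<theta> in auto)
  then have "eventually (\<lambda>m. C' * \<theta> ^ m < 1 / 4) sequentially"
    by (rule order_tendstoD) auto
  then obtain m where m: "C' * \<theta> ^ m < 1 / 4" by (auto simp: eventually_sequentially)
  define \<epsilon> where "\<epsilon> = u / (8 * (real m + 1))"
  have \<epsilon>: "0 < \<epsilon>" "real m * \<epsilon> \<le> u / 8" "\<epsilon> \<le> u / 8"
    using u by (auto simp: \<epsilon>_def field_simps)
  obtain N where N: "\<And>k. k \<ge> N \<Longrightarrow> \<bar>K (Suc k) - K k\<bar> < \<epsilon>"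
    using LIMSEQ_D[OF small_steps \<epsilon>(1)] by auto
  obtain k0 where k0: "k0 \<ge> N" "K k0 < u / 8" using inf0[of "u/8" N] u by auto
  have near: "\<bar>K (k + l) - K k\<bar> \<le> real l * \<epsilon>" if "k \<ge> N" for k l
  proof (induction l)
    case (Suc l)
    then show ?case using N[of "k + l"] that by (auto simp: algebra_simps)
  qed simp
  have geo: "b k \<le> \<theta> ^ l * b (k + l)" if "\<And>i. k < i \<Longrightarrow> i \<le> k + l \<Longrightarrow> K i < u" for k l
    using that
  proof (induction l)
    case (Suc l)
    have "b k \<le> \<theta> ^ l * b (k + l)" using Suc by auto
    also have "\<dots> \<le> \<theta> ^ l * (\<theta> * b (Suc (k + l)))"
      using Suc.prems[of "Suc (k + l)"] \<theta> by (intro mult_left_mono grow) auto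
    finally show ?case by (simp add: mult_ac)
  qed simp
  have "\<exists>k\<ge>k0. u / 2 \<le> K k"
  proof (rule ccontr)
    assume "\<not> ?thesis"
    then have lt: "K k < u" if "k \<ge> k0" for k using that u by force
    have "b k0 \<le> \<theta> ^ l * u" for l
    proof -
      have "b k0 \<le> \<theta> ^ l * b (k0 + l)" by (rule geo) (use lt in auto)
      also have "\<dots> \<le> \<theta> ^ l * u"
        using lt[of "k0 + l"] b_le[of "k0 + l"] \<theta> by (intro mult_left_mono) auto
      finally show ?thesis .
    qed
    moreover have "(\<lambda>l. \<theta> ^ l * u) \<longlonglongrightarrow> 0 * u"
      by (intro tendsto_mult tendsto_const LIMSEQ_realpow_zero) (use \<theta> in auto)
    ultimately have "b k0 \<le> 0 * u" by (intro LIMSEQ_le_const) auto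
    then show False using b_pos[of k0] by simp
  qed
  then obtain k1 where k1: "k1 \<ge> k0" "u / 2 \<le> K k1"
    and first: "\<And>k. k0 \<le> k \<Longrightarrow> k < k1 \<Longrightarrow> K k < u / 2"
    using exists_least_iff[of "\<lambda>k. k \<ge> k0 \<and> u / 2 \<le> K k"] by (metis not_le)
  have k1_gt: "k1 \<ge> k0 + m"
  proof (rule ccontr)
    assume "\<not> ?thesis"
    then obtain l where l: "k1 = k0 + l" "l \<le> m" using k1(1) by (metis le_add_diff_inverse nat_le_linear add_le_cancel_left)
    have "real l * \<epsilon> \<le> real m * \<epsilon>" using l \<epsilon> by simp
    moreover have "K k1 \<le> K k0 + real l * \<epsilon>" using near[of k0 l] l k0 by (simp add: abs_le_iff)
    ultimately show False using k0 k1 \<epsilon> by linarith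
  qed
  define k2 where "k2 = k1 - m"
  have k2: "k1 = k2 + m" "k2 \<ge> k0" using k1_gt by (auto simp: k2_def)
  obtain k' where k': "k1 = Suc k'" using k1 k0 u by (cases k1) auto
  have "k' \<ge> k0" using k' k1 k0 u by (cases "k1 = k0") auto
  then have "K k1 < u / 2 + \<epsilon>" using first[of k'] N[of k'] k0 k' by (simp add: abs_less_iff)
  then have K1: "K k1 \<le> 5 / 8 * u" using \<epsilon> by simp
  have lt: "K k < u" if "k0 \<le> k" "k \<le> k1" for k
    using that first[of k] K1 u by (cases "k = k1") auto
  have up: "k0 + l \<le> k1 \<Longrightarrow> K (k0 + l) \<le> K k0 + C' * (b (k0 + l) - b k0)" for l
  proof (induction l)
    case (Suc l)
    have "b (k0 + l) \<le> \<theta> * b (Suc (k0 + l))" using lt[of "Suc (k0 + l)"] Suc by (intro grow) auto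
    then have "C' * ((1 - \<theta>) * b (Suc (k0 + l))) \<le> C' * (b (Suc (k0 + l)) - b (k0 + l))"
      using C' by (intro mult_left_mono) (auto simp: algebra_simps)
    then show ?case using Suc incr[of "k0 + l"] C'(2) by (simp add: algebra_simps)
  qed simp
  have "C' * b k2 \<le> C' * (\<theta> ^ m * b k1)"
    unfolding k2(1) using C' lt k2 by (intro mult_left_mono geo) auto
  also have "\<dots> \<le> 1 / 4 * b k1"
    using m b_pos[of k1] by (simp add: mult.assoc[symmetric] mult_right_mono del: times_divide_eq_left)
  also have "\<dots> \<le> 1 / 4 * K k1" using b_le[of k1] by simp
  finally have "C' * b k2 \<le> 5 / 32 * u" using K1 by simp
  moreover have "K k2 \<le> K k0 + C' * (b k2 - b k0)" using up[of "k2 - k0"] k2 by simp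
  moreover have "0 \<le> C' * b k0" using C' b_pos[of k0] by simp
  moreover have "K k1 \<le> K k2 + u / 8"
    using near[of k2 m] k2 k0 \<epsilon> by (simp add: abs_le_iff)
  ultimately show False using k1(2) k0(2) u by (simp add: algebra_simps)
qed

lemma tendsto_1_if_log_defect_tendsto_0:
  fixes x :: "nat \<Rightarrow> real"
  assumes pos: "\<And>n. 0 < x n" and lim: "(\<lambda>n. x n - 1 - ln (x n)) \<longlonglongrightarrow> 0"
  shows "x \<longlonglongrightarrow> 1"
proof -
  have "(sqrt (x n) - 1)\<^sup>2 \<le> x n - 1 - ln (x n)" for n
    using pos[of n] ln_le_minus_one[of "sqrt (x n)"] by (simp add: ln_sqrt power2_diff)
  then have "(\<lambda>n. (sqrt (x n) - 1)\<^sup>2) \<longlonglongrightarrow> 0"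
    by (intro tendsto_sandwich[OF _ _ tendsto_const lim]) auto
  then have "(\<lambda>n. sqrt ((sqrt (x n) - 1)\<^sup>2)) \<longlonglongrightarrow> sqrt 0" by (intro tendsto_intros)
  then have "(\<lambda>n. sqrt (x n) - 1) \<longlonglongrightarrow> 0" by (simp add: tendsto_rabs_zero_iff)
  then have "(\<lambda>n. (sqrt (x n) - 1 + 1)\<^sup>2) \<longlonglongrightarrow> (0 + 1)\<^sup>2" by (intro tendsto_intros)
  then show ?thesis using pos by (simp add: less_imp_le)
qed

locale prox_sequence = monotone_game A v g
  for A :: "'n::finite \<Rightarrow> 'a::finite set" and v and g +
  fixes \<sigma> :: "nat \<Rightarrow> ('n, 'a) profile" and s t :: "nat \<Rightarrow> 'n \<Rightarrow> real" and c \<beta> :: real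
  assumes c: "0 < c" and \<beta>: "0 < \<beta>" and init: "\<sigma> 0 \<in> strat_interior A"
    and step: "\<And>k. prox_step c \<beta> (\<sigma> k) (\<sigma> (Suc k)) (s k) (t k)"
begin

lemma int: "\<sigma> k \<in> strat_interior A"
  using init step by (cases k) (auto simp: prox_step_def)

lemma in_X: "\<sigma> k \<in> X" by (rule strat_interiorD(1)[OF int])

lemma pos: "j \<in> A i \<Longrightarrow> 0 < \<sigma> k $ (i, j)" by (rule strat_interiorD(2)[OF int])

definition \<rho> :: "nat \<Rightarrow> 'n \<Rightarrow> 'a \<Rightarrow> real" where
  "\<rho> k i j = (\<sigma> k $ (i, j) / \<sigma> (Suc k) $ (i, j)) powr \<beta> / t k i"

lemma s: "s k i \<le> 1" and t: "0 < t k i" "t k i \<le> 1"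
  and adv_step: "j \<in> A i \<Longrightarrow> adv i j (\<sigma> (Suc k)) = c * (s k i - \<rho> k i j)"
  using step[of k] by (auto simp: prox_step_def \<rho>_def)

lemma \<rho>_pos: "j \<in> A i \<Longrightarrow> 0 < \<rho> k i j"
  using pos[of j i k] pos[of j i "Suc k"] t(1)[of k i] by (simp add: \<rho>_def)

lemma ln_\<rho>:
  "j \<in> A i \<Longrightarrow> ln (\<rho> k i j) = \<beta> * (ln (\<sigma> k $ (i, j)) - ln (\<sigma> (Suc k) $ (i, j))) - ln (t k i)"
  using pos[of j i k] pos[of j i "Suc k"] t(1)[of k i] by (simp add: \<rho>_def ln_div ln_powr)

definition diss :: "('n, 'a) profile \<Rightarrow> nat \<Rightarrow> real" where
  "diss p k = (\<Sum>i\<in>UNIV. (1 - s k i) + (- ln (t k i)) + (\<Sum>j\<in>A i. p $ (i, j) * (\<rho> k i j - 1 - ln (\<rho> k i j))))"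

lemma log_defect_nonneg: "j \<in> A i \<Longrightarrow> 0 \<le> \<rho> k i j - 1 - ln (\<rho> k i j)"
  using ln_le_minus_one[OF \<rho>_pos] by simp

lemma diss_terms_nonneg:
  assumes "p \<in> X"
  shows "0 \<le> 1 - s k i" "0 \<le> - ln (t k i)" "0 \<le> (\<Sum>j\<in>A i. p $ (i, j) * (\<rho> k i j - 1 - ln (\<rho> k i j)))"
  using s[of k i] t[of k i] strat_spaceD(1)[OF assms] log_defect_nonneg
  by (auto intro!: sum_nonneg mult_nonneg_nonneg simp: ln_le_zero_iff)

lemma diss_nonneg: "p \<in> X \<Longrightarrow> 0 \<le> diss p k"
  unfolding diss_def by (rule sum_nonneg) (intro add_nonneg_nonneg diss_terms_nonneg)

lemma energy_identity:
  assumes p: "p \<in> X"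
  shows "W (\<sigma> (Suc k)) p = c * (\<beta> * (KL A p (\<sigma> k) - KL A p (\<sigma> (Suc k))) - diss p k)"
proof -
  have "(\<Sum>j\<in>A i. p $ (i, j) * adv i j (\<sigma> (Suc k)))
      = c * (\<beta> * (\<Sum>j\<in>A i. p $ (i, j) * (ln (\<sigma> (Suc k) $ (i, j)) - ln (\<sigma> k $ (i, j))))
         - ((1 - s k i) + (- ln (t k i)) + (\<Sum>j\<in>A i. p $ (i, j) * (\<rho> k i j - 1 - ln (\<rho> k i j)))))" for i
  proof -
    let ?D = "\<lambda>j. ln (\<sigma> (Suc k) $ (i, j)) - ln (\<sigma> k $ (i, j))"
    have "(\<Sum>j\<in>A i. p $ (i, j) * adv i j (\<sigma> (Suc k)))
        = (\<Sum>j\<in>A i. c * (\<beta> * (p $ (i, j) * ?D j) + p $ (i, j) * (s k i - 1 + ln (t k i))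
            - p $ (i, j) * (\<rho> k i j - 1 - ln (\<rho> k i j))))"
      by (intro sum.cong refl) (simp add: adv_step ln_\<rho> algebra_simps)
    also have "\<dots> = c * (\<beta> * (\<Sum>j\<in>A i. p $ (i, j) * ?D j) + (\<Sum>j\<in>A i. p $ (i, j)) * (s k i - 1 + ln (t k i))
        - (\<Sum>j\<in>A i. p $ (i, j) * (\<rho> k i j - 1 - ln (\<rho> k i j))))"
      by (simp add: sum_distrib_left[symmetric] sum_distrib_right[symmetric] sum.distrib sum_subtractf)
    finally show ?thesis using strat_spaceD(2)[OF p] by (simp add: algebra_simps)
  qed
  then have "W (\<sigma> (Suc k)) p = (\<Sum>i\<in>UNIV. c * (\<beta> * (\<Sum>j\<in>A i. p $ (i, j) * (ln (\<sigma> (Suc k) $ (i, j)) - ln (\<sigma> k $ (i, j))))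
         - ((1 - s k i) + (- ln (t k i)) + (\<Sum>j\<in>A i. p $ (i, j) * (\<rho> k i j - 1 - ln (\<rho> k i j))))))"
    by (simp add: pairing_eq_advantage[OF p])
  also have "\<dots> = c * (\<beta> * (KL A p (\<sigma> k) - KL A p (\<sigma> (Suc k))) - diss p k)"
    unfolding KL_diff[OF int int p] diss_def
    by (simp only: sum_distrib_left[symmetric] sum_subtractf)
  finally show ?thesis .
qed

lemma KL_step:
  assumes p: "p \<in> X"
  shows "\<beta> * (KL A p (\<sigma> (Suc k)) - KL A p (\<sigma> k)) \<le> W p (\<sigma> (Suc k)) / c"
proof -
  have "0 \<le> c * (\<beta> * (KL A p (\<sigma> k) - KL A p (\<sigma> (Suc k))) - diss p k) + W p (\<sigma> (Suc k))"
    using pairing_swap[OF in_X p, of "Suc k"] energy_identity[OF p, of k] by simp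
  then have "0 \<le> (\<beta> * (KL A p (\<sigma> k) - KL A p (\<sigma> (Suc k))) - diss p k) + W p (\<sigma> (Suc k)) / c"
    using c by (simp add: field_simps)
  then show ?thesis using diss_nonneg[OF p, of k] by (simp add: algebra_simps)
qed

text \<open>The point \<open>q\<close> is a limit point of the running averages of the sequence.\<close>
lemma ergodic_limit:
  "\<exists>q\<in>X. (\<forall>p\<in>X. 0 \<le> W p q) \<and> (\<forall>\<epsilon>>0. \<forall>N. \<exists>k\<ge>N. (\<Sum>l | q $ l = 0. \<sigma> k $ l) < \<epsilon>)"
proof -
  define avg where "avg n = (1 / real (Suc n)) *\<^sub>R (\<Sum>k\<le>n. \<sigma> (Suc k))" for n
  have avg_X: "avg n \<in> X" for n
    unfolding avg_def scaleR_sum_right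
    by (rule convex_sum) (use convex_strat_space in_X in auto)
  obtain q r where q: "q \<in> X" and r: "strict_mono r" and lim: "(avg \<circ> r) \<longlonglongrightarrow> q"
    using compact_strat_space[unfolded compact_def, rule_format, of avg] avg_X by blast
  have inv: "(\<lambda>n. C / real (Suc (r n))) \<longlonglongrightarrow> 0" for C :: real
    using LIMSEQ_subseq_LIMSEQ[OF LIMSEQ_Suc[OF lim_const_over_n] r, of C] by (simp add: o_def)
  have "0 \<le> W p q" if p: "p \<in> X" for p
  proof -
    define w :: "('n, 'a) profile" where "w = (\<chi> l. if snd l \<in> A (fst l) then g (fst l) p $ l else 0)"
    have W: "W p y = w \<bullet> (y - p)" for y
    proof -
      have "w \<bullet> (y - p) = (\<Sum>l\<in>UNIV. w $ l * (y $ l - p $ l))" by (simp add: inner_vec_def)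
      also have "\<dots> = (\<Sum>l\<in>Sigma UNIV A. g (fst l) p $ l * (y $ l - p $ l))"
        by (rule sum.mono_neutral_cong_right) (auto simp: w_def)
      finally show ?thesis by (simp add: pairing_def sum.Sigma case_prod_unfold)
    qed
    have bound: "- (c * \<beta> * KL A p (\<sigma> 0)) / real (Suc n) \<le> W p (avg n)" for n
    proof -
      have "\<beta> * (KL A p (\<sigma> (Suc n)) - KL A p (\<sigma> 0)) = (\<Sum>k\<le>n. \<beta> * (KL A p (\<sigma> (Suc k)) - KL A p (\<sigma> k)))"
        unfolding sum_distrib_left[symmetric] by (subst sum_telescope[of "\<lambda>k. - KL A p (\<sigma> k)", simplified]) simp
      also have "\<dots> \<le> (\<Sum>k\<le>n. W p (\<sigma> (Suc k)) / c)" by (intro sum_mono KL_step p)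
      finally have "- (c * \<beta> * KL A p (\<sigma> 0)) \<le> (\<Sum>k\<le>n. W p (\<sigma> (Suc k)))"
        using c mult_nonneg_nonneg[OF mult_nonneg_nonneg KL_nonneg[OF p int], of c \<beta> "Suc n"] \<beta>
        by (simp add: sum_divide_distrib[symmetric] field_simps)
      also have "\<dots> = real (Suc n) * W p (avg n)"
        by (simp add: W avg_def inner_diff_right inner_sum_right sum_subtractf field_simps)
      finally show ?thesis by (simp add: field_simps)
    qed
    have "(\<lambda>n. W p (avg (r n))) \<longlonglongrightarrow> W p q"
      unfolding W using lim by (intro tendsto_intros) (simp add: o_def)
    then show ?thesis by (rule LIMSEQ_le[OF inv]) (use bound in blast)
  qed
  moreover have "\<exists>k\<ge>N. (\<Sum>l | q $ l = 0. \<sigma> k $ l) < \<epsilon>" if "\<epsilon> > 0" for \<epsilon> N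
  proof (rule ccontr)
    define M where "M y = (\<Sum>l | q $ l = 0. y $ l)" for y :: "('n, 'a) profile"
    assume "\<not> ?thesis"
    then have ge: "\<epsilon> \<le> M (\<sigma> k)" if "k \<ge> N" for k using that by (force simp: M_def)
    have M_nonneg: "0 \<le> M (\<sigma> k)" for k
      unfolding M_def by (rule sum_nonneg) (metis in_X strat_spaceD(1) surj_pair)
    have "\<epsilon> - \<epsilon> * real N / real (Suc n) \<le> M (avg n)" for n
    proof -
      have "\<epsilon> * (real (Suc n) - real N) \<le> (\<Sum>k\<in>{N..n}. \<epsilon>)"
        using that by (cases "N \<le> Suc n") (auto simp: of_nat_diff mult_le_0_iff intro: order_trans[of _ 0])
      also have "\<dots> \<le> (\<Sum>k\<in>{N..n}. M (\<sigma> (Suc k)))" by (intro sum_mono ge) auto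
      also have "\<dots> \<le> (\<Sum>k\<le>n. M (\<sigma> (Suc k)))" by (intro sum_mono2 M_nonneg) auto
      also have "\<dots> = real (Suc n) * M (avg n)"
        unfolding M_def avg_def by (subst sum.swap) (simp add: sum_distrib_left del: of_nat_Suc)
      finally show ?thesis by (simp add: field_simps)
    qed
    then have "\<epsilon> - \<epsilon> * real N / real (Suc (r n)) \<le> M (avg (r n))" for n by blast
    moreover have "(\<lambda>n. M (avg (r n))) \<longlonglongrightarrow> M q"
      unfolding M_def using lim by (intro tendsto_intros) (simp add: o_def)
    moreover have "(\<lambda>n. \<epsilon> - \<epsilon> * real N / real (Suc (r n))) \<longlonglongrightarrow> \<epsilon> - 0"
      by (intro tendsto_intros inv)
    ultimately have "\<epsilon> - 0 \<le> M q" by (intro LIMSEQ_le) auto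
    then show False using that by (simp add: M_def)
  qed
  ultimately show ?thesis using q by blast
qed

lemma ratios_tendsto_1:
  assumes q: "q \<in> X" and minty: "\<And>p. p \<in> X \<Longrightarrow> 0 \<le> W p q" and q_pos: "0 < q $ (i, j)"
  shows "(\<lambda>k. adv i j (\<sigma> k)) \<longlonglongrightarrow> 0" "(\<lambda>k. ln (\<sigma> k $ (i, j)) - ln (\<sigma> (Suc k) $ (i, j))) \<longlonglongrightarrow> 0"
proof -
  have j: "j \<in> A i" using strat_spaceD(3)[OF q, of j i] q_pos by auto
  let ?K = "\<lambda>k. KL A q (\<sigma> k)"
  have diss_le: "diss q k \<le> \<beta> * (?K k - ?K (Suc k))" for k
    using minty[OF in_X, of "Suc k"] energy_identity[OF q, of k] c by (simp add: zero_le_mult_iff)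
  then have "0 \<le> \<beta> * (?K k - ?K (Suc k))" for k using diss_nonneg[OF q] order_trans by blast
  then have "decseq ?K" using \<beta> by (intro decseq_SucI) (simp add: zero_le_mult_iff)
  then obtain L where L: "?K \<longlonglongrightarrow> L" using decseq_convergent[of ?K 0] KL_nonneg[OF q int] by blast
  then have "(\<lambda>k. \<beta> * (?K k - ?K (Suc k))) \<longlonglongrightarrow> \<beta> * (L - L)"
    by (intro tendsto_intros LIMSEQ_Suc[OF L])
  then have K_diff: "(\<lambda>k. \<beta> * (?K k - ?K (Suc k))) \<longlonglongrightarrow> 0" by simp
  have diss_0: "diss q \<longlonglongrightarrow> 0"
    using diss_le diss_nonneg[OF q] by (intro tendsto_sandwich[OF _ _ tendsto_const K_diff]) auto
  have part: "(1 - s k i) + (- ln (t k i)) + (\<Sum>j\<in>A i. q $ (i, j) * (\<rho> k i j - 1 - ln (\<rho> k i j))) \<le> diss q k" for k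
    unfolding diss_def using diss_terms_nonneg[OF q]
    by (intro member_le_sum[of i UNIV "\<lambda>i. (1 - s k i) + (- ln (t k i)) + (\<Sum>j\<in>A i. q $ (i, j) * (\<rho> k i j - 1 - ln (\<rho> k i j)))"] add_nonneg_nonneg) auto
  have parts: "1 - s k i \<le> diss q k" "- ln (t k i) \<le> diss q k"
    "(\<Sum>j\<in>A i. q $ (i, j) * (\<rho> k i j - 1 - ln (\<rho> k i j))) \<le> diss q k" for k
    using part[of k] diss_terms_nonneg[OF q, where k = k and i = i] by linarith+
  have "q $ (i, j) * (\<rho> k i j - 1 - ln (\<rho> k i j)) \<le> (\<Sum>j\<in>A i. q $ (i, j) * (\<rho> k i j - 1 - ln (\<rho> k i j)))" for k
    using j strat_spaceD(1)[OF q] log_defect_nonneg by (intro member_le_sum) auto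
  then have q_le: "q $ (i, j) * (\<rho> k i j - 1 - ln (\<rho> k i j)) \<le> diss q k" for k
    using parts(3)[of k] order_trans by blast
  have "(\<lambda>k. 1 - s k i) \<longlonglongrightarrow> 0"
    by (rule tendsto_sandwich[OF _ _ tendsto_const diss_0])
       (use parts(1) diss_terms_nonneg(1)[OF q] in auto)
  then have "(\<lambda>k. 1 - (1 - s k i)) \<longlonglongrightarrow> 1 - 0" by (intro tendsto_intros)
  then have s1: "(\<lambda>k. s k i) \<longlonglongrightarrow> 1" by simp
  have "(\<lambda>k. - ln (t k i)) \<longlonglongrightarrow> 0"
    by (rule tendsto_sandwich[OF _ _ tendsto_const diss_0])
       (use parts(2) diss_terms_nonneg(2)[OF q] in auto)
  then have lnt: "(\<lambda>k. ln (t k i)) \<longlonglongrightarrow> 0" using tendsto_minus by fastforce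
  have "(\<lambda>k. \<rho> k i j - 1 - ln (\<rho> k i j)) \<longlonglongrightarrow> 0"
  proof (rule tendsto_sandwich[OF _ _ tendsto_const])
    have "(\<lambda>k. diss q k / q $ (i, j)) \<longlonglongrightarrow> 0 / q $ (i, j)" using diss_0 q_pos by (intro tendsto_intros) auto
    then show "(\<lambda>k. diss q k / q $ (i, j)) \<longlonglongrightarrow> 0" by simp
    show "\<forall>\<^sub>F k in sequentially. \<rho> k i j - 1 - ln (\<rho> k i j) \<le> diss q k / q $ (i, j)"
      using q_le q_pos by (intro always_eventually) (simp add: field_simps)
  qed (use log_defect_nonneg[OF j] in auto)
  then have \<rho>1: "(\<lambda>k. \<rho> k i j) \<longlonglongrightarrow> 1" by (rule tendsto_1_if_log_defect_tendsto_0[rotated]) (rule \<rho>_pos[OF j])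
  have "(\<lambda>k. c * (s k i - \<rho> k i j)) \<longlonglongrightarrow> c * (1 - 1)" by (intro tendsto_intros s1 \<rho>1)
  then have "(\<lambda>k. adv i j (\<sigma> (Suc k))) \<longlonglongrightarrow> 0" by (simp add: adv_step[OF j])
  then show "(\<lambda>k. adv i j (\<sigma> k)) \<longlonglongrightarrow> 0" by (rule LIMSEQ_imp_Suc)
  have "(\<lambda>k. (ln (\<rho> k i j) + ln (t k i)) / \<beta>) \<longlonglongrightarrow> (ln 1 + 0) / \<beta>" using \<beta> by (intro tendsto_intros \<rho>1 lnt) auto
  then show "(\<lambda>k. ln (\<sigma> k $ (i, j)) - ln (\<sigma> (Suc k) $ (i, j))) \<longlonglongrightarrow> 0" using \<beta> by (simp add: ln_\<rho>[OF j])
qed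

lemma limit_point_inside_support:
  assumes q: "\<And>\<epsilon> N. 0 < \<epsilon> \<Longrightarrow> \<exists>k\<ge>N. (\<Sum>l | q $ l = 0. \<sigma> k $ l) < \<epsilon>"
  shows "\<exists>x\<in>X. \<exists>\<kappa>. filterlim \<kappa> at_top sequentially \<and> (\<lambda>n. \<sigma> (\<kappa> n)) \<longlonglongrightarrow> x \<and> (\<forall>l. q $ l = 0 \<longrightarrow> x $ l = 0)"
proof -
  let ?M = "\<lambda>y :: ('n, 'a) profile. \<Sum>l | q $ l = 0. y $ l"
  have "\<exists>k\<ge>n. ?M (\<sigma> k) < 1 / real (Suc n)" for n by (rule q) simp
  then obtain h where h: "\<And>n. h n \<ge> n" "\<And>n. ?M (\<sigma> (h n)) < 1 / real (Suc n)" by metis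
  obtain x r where x: "x \<in> X" and r: "strict_mono r" and lim: "((\<lambda>n. \<sigma> (h n)) \<circ> r) \<longlonglongrightarrow> x"
    using compact_strat_space[unfolded compact_def, rule_format, of "\<lambda>n. \<sigma> (h n)"] in_X by blast
  have "(\<lambda>n. ?M (\<sigma> (h (r n)))) \<longlonglongrightarrow> ?M x" using lim by (intro tendsto_intros) (simp add: o_def)
  moreover have "(\<lambda>n. 1 / real (Suc (r n))) \<longlonglongrightarrow> 0"
    using LIMSEQ_subseq_LIMSEQ[OF LIMSEQ_Suc[OF lim_const_over_n] r, of 1] by (simp add: o_def)
  ultimately have "?M x \<le> 0" using h(2) by (intro LIMSEQ_le) (auto intro: less_imp_le)
  moreover have nonneg: "0 \<le> x $ l" for l by (metis x strat_spaceD(1) surj_pair)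
  ultimately have "?M x = 0" by (intro antisym sum_nonneg) auto
  then have "\<forall>l. q $ l = 0 \<longrightarrow> x $ l = 0" using nonneg by (subst (asm) sum_nonneg_eq_0_iff) auto
  moreover have "filterlim (\<lambda>n. h (r n)) at_top sequentially"
    by (rule filterlim_at_top_mono[OF filterlim_ident])
       (use h(1) seq_suble[OF r] in \<open>auto intro!: always_eventually intro: order_trans\<close>)
  ultimately show ?thesis using x lim by (intro bexI[of _ x] exI[of _ "\<lambda>n. h (r n)"]) (auto simp: o_def)
qed

end

context prox_sequence
begin

lemma converges_to_nash: "\<exists>x\<in>nash_equilibria A v. (\<lambda>k. KL A x (\<sigma> k)) \<longlonglongrightarrow> 0"
proof -
  obtain q where q: "q \<in> X" "\<And>p. p \<in> X \<Longrightarrow> 0 \<le> W p q"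
    and visits: "\<And>\<epsilon> N. 0 < \<epsilon> \<Longrightarrow> \<exists>k\<ge>N. (\<Sum>l | q $ l = 0. \<sigma> k $ l) < \<epsilon>"
    using ergodic_limit by blast
  obtain x \<kappa> where x: "x \<in> X" and \<kappa>: "filterlim \<kappa> at_top sequentially" and lim: "(\<lambda>n. \<sigma> (\<kappa> n)) \<longlonglongrightarrow> x"
    and supp: "\<And>l. q $ l = 0 \<Longrightarrow> x $ l = 0"
    using limit_point_inside_support[OF visits] by blast
  have q_cases: "q $ (i, j) = 0 \<or> 0 < q $ (i, j)" for i j using strat_spaceD(1)[OF q(1), of i j] by linarith
  have adv_le: "adv i j x \<le> 0" if "0 < q $ (i, j)" for i j
  proof (rule ccontr)
    assume "\<not> ?thesis"
    then have a: "0 < adv i j x" by simp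
    have j: "j \<in> A i" using strat_spaceD(3)[OF q(1), of j i] that by auto
    obtain \<epsilon> where \<epsilon>: "\<epsilon> > 0" "\<And>\<pi>. \<pi> \<in> X \<Longrightarrow> dist \<pi> x < \<epsilon> \<Longrightarrow> adv i j x / 2 < adv i j \<pi>"
      using advantage_lsc[OF x j, of "adv i j x / 2"] a by auto
    have "\<forall>\<^sub>F n in sequentially. dist (\<sigma> (\<kappa> n)) x < \<epsilon>" using lim \<epsilon>(1) by (rule tendstoD)
    then have 1: "\<forall>\<^sub>F n in sequentially. adv i j x / 2 < adv i j (\<sigma> (\<kappa> n))"
      by eventually_elim (use \<epsilon>(2) in_X in blast)
    have "(\<lambda>n. adv i j (\<sigma> (\<kappa> n))) \<longlonglongrightarrow> 0"
      by (rule filterlim_compose[OF ratios_tendsto_1(1)[OF q that] \<kappa>])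
    then have "\<forall>\<^sub>F n in sequentially. adv i j (\<sigma> (\<kappa> n)) < adv i j x / 2"
      by (rule order_tendstoD) (use a in simp)
    with 1 have "\<forall>\<^sub>F n :: nat in sequentially. False" by eventually_elim simp
    then show False by simp
  qed
  define B where "B = {(i, j). j \<in> A i \<and> 0 < adv i j x}"
  define K where "K k = KL A x (\<sigma> k)" for k
  define b where "b k = (\<Sum>l\<in>B. \<sigma> k $ l)" for k
  define R where "R = (\<Sum>(i, j)\<in>B. adv i j x)"
  have x_B: "x $ (i, j) = 0" if "(i, j) \<in> B" for i j
    using that adv_le[of i j] q_cases[of i j] supp[of "(i, j)"] by (auto simp: B_def)
  have K_nonneg: "0 \<le> K k" for k unfolding K_def by (rule KL_nonneg[OF x int])
  have b_le: "b k \<le> K k" for k unfolding b_def K_def by (rule KL_ge_mass[OF x int x_B])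
  have B_pos: "0 < \<sigma> k $ l" if "l \<in> B" for k l using that pos by (auto simp: B_def)
  have R: "0 \<le> R" unfolding R_def by (rule sum_nonneg) (auto simp: B_def)
  have drift: "K (Suc k) \<le> K k + R / (c * \<beta>) * b (Suc k)" for k
  proof -
    have "W x (\<sigma> (Suc k)) = (\<Sum>(i, j)\<in>Sigma UNIV A. \<sigma> (Suc k) $ (i, j) * adv i j x)"
      by (simp add: pairing_eq_advantage[OF in_X] sum.Sigma)
    also have "\<dots> \<le> (\<Sum>(i, j)\<in>B. \<sigma> (Suc k) $ (i, j) * adv i j x)"
    proof -
      have "(\<Sum>(i, j)\<in>Sigma UNIV A - B. \<sigma> (Suc k) $ (i, j) * adv i j x) \<le> 0"
        using strat_spaceD(1)[OF in_X] by (intro sum_nonpos) (auto simp: B_def not_less intro!: mult_nonneg_nonpos)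
      moreover have "B \<subseteq> Sigma UNIV A" by (auto simp: B_def)
      ultimately show ?thesis by (subst sum.subset_diff[of B]) auto
    qed
    also have "\<dots> \<le> (\<Sum>(i, j)\<in>B. \<sigma> (Suc k) $ (i, j) * R)"
    proof (intro sum_mono, clarify)
      fix i j assume ij: "(i, j) \<in> B"
      have "(\<lambda>(i, j). adv i j x) (i, j) \<le> R" unfolding R_def
        by (rule member_le_sum[OF ij]) (auto simp: B_def)
      then show "\<sigma> (Suc k) $ (i, j) * adv i j x \<le> \<sigma> (Suc k) $ (i, j) * R"
        using B_pos[OF ij, of "Suc k"] by (intro mult_left_mono) auto
    qed
    also have "\<dots> = R * b (Suc k)" by (simp add: b_def sum_distrib_left case_prod_unfold mult.commute)
    finally have "W x (\<sigma> (Suc k)) / c \<le> R * b (Suc k) / c" using c by (simp add: divide_right_mono)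
    then have "\<beta> * (K (Suc k) - K k) \<le> R * b (Suc k) / c"
      using KL_step[OF x, of k] by (simp add: K_def)
    then show ?thesis using \<beta> c by (simp add: field_simps)
  qed
  have K_lim: "(\<lambda>n. K (\<kappa> n)) \<longlonglongrightarrow> 0" unfolding K_def by (rule KL_tendsto_0[OF x int lim])
  have recur: "\<exists>k\<ge>N. K k < \<epsilon>" if "0 < \<epsilon>" for \<epsilon> N
  proof -
    have "\<forall>\<^sub>F n in sequentially. K (\<kappa> n) < \<epsilon> \<and> \<kappa> n \<ge> N"
      using order_tendstoD(2)[OF K_lim that] \<kappa> by (intro eventually_conj) (auto simp: filterlim_at_top)
    then show ?thesis using eventually_happens[of _ sequentially] by force
  qed
  have "B = {}"
  proof (rule ccontr)
    assume B: "B \<noteq> {}"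
    have "(\<lambda>k. K (Suc k) - K k) \<longlonglongrightarrow> 0"
    proof -
      have "(\<lambda>k. x $ (i, j) * (ln (\<sigma> k $ (i, j)) - ln (\<sigma> (Suc k) $ (i, j)))) \<longlonglongrightarrow> 0" for i j
      proof (cases "q $ (i, j) = 0")
        case False
        then show ?thesis using q_cases[of i j] by (intro tendsto_mult_right_zero ratios_tendsto_1(2)[OF q]) auto
      qed (simp add: supp)
      then show ?thesis unfolding K_def KL_diff[OF int int x] by (intro tendsto_null_sum)
    qed
    moreover define y where "y = min (c / 2) (Min ((\<lambda>(i, j). adv i j x) ` B) / 2)"
    have y: "0 < y" "y < c" using B c by (auto simp: y_def B_def)
    have y_less: "y < adv i j x" if "(i, j) \<in> B" for i j
    proof -
      have "Min ((\<lambda>(i, j). adv i j x) ` B) \<le> adv i j x" using that by (intro Min_le) force+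
      moreover have "0 < adv i j x" using that by (simp add: B_def)
      ultimately show ?thesis by (auto simp: y_def min_def)
    qed
    have "\<exists>\<epsilon>>0. \<forall>\<pi>\<in>X. dist \<pi> x < \<epsilon> \<longrightarrow> y < adv (fst l) (snd l) \<pi>" if "l \<in> B" for l
      using that y_less[of "fst l" "snd l"] by (intro advantage_lsc[OF x]) (auto simp: B_def)
    then obtain e where e: "\<And>l. l \<in> B \<Longrightarrow> 0 < e l"
      "\<And>l \<pi>. l \<in> B \<Longrightarrow> \<pi> \<in> X \<Longrightarrow> dist \<pi> x < e l \<Longrightarrow> y < adv (fst l) (snd l) \<pi>" by metis
    have "0 < Min (e ` B)" using B e(1) by (subst Min_gr_iff) auto
    then obtain u where u: "u > 0" "\<And>\<pi>. \<pi> \<in> strat_interior A \<Longrightarrow> KL A x \<pi> < u \<Longrightarrow> dist \<pi> x < Min (e ` B)"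
      using KL_small_imp_near[OF x] by blast
    define \<theta> where "\<theta> = (1 - y / c) powr (1 / \<beta>)"
    have \<theta>: "0 < \<theta>" "\<theta> < 1"
      using y c \<beta> powr_less_mono2[of "1 / \<beta>" "1 - y / c" 1] by (auto simp: \<theta>_def)
    have "b k \<le> \<theta> * b (Suc k)" if "K (Suc k) < u" for k
    proof -
      have near: "dist (\<sigma> (Suc k)) x < Min (e ` B)" using u(2)[OF int] that by (simp add: K_def)
      have "\<sigma> k $ (i, j) \<le> \<theta> * \<sigma> (Suc k) $ (i, j)" if ij: "(i, j) \<in> B" for i j
      proof -
        let ?r = "\<sigma> k $ (i, j) / \<sigma> (Suc k) $ (i, j)"
        have j: "j \<in> A i" using ij by (simp add: B_def)
        have "dist (\<sigma> (Suc k)) x < e (i, j)" using near ij by (simp add: less_le_trans)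
        then have "y < c * (s k i - \<rho> k i j)" using e(2)[OF ij in_X, of "Suc k"] by (simp add: adv_step[OF j])
        also have "\<dots> \<le> c * (1 - \<rho> k i j)" using c s by (intro mult_left_mono) auto
        finally have \<rho>_less: "\<rho> k i j < 1 - y / c" using c by (simp add: field_simps)
        have "?r powr \<beta> \<le> \<rho> k i j"
          using t[of k i] by (simp add: \<rho>_def field_simps mult_left_le_one_le)
        then have "?r powr \<beta> < 1 - y / c" using \<rho>_less by simp
        then have "(?r powr \<beta>) powr (1 / \<beta>) \<le> \<theta>" unfolding \<theta>_def using \<beta> by (intro powr_mono2) auto
        then have "?r \<le> \<theta>" using \<beta> pos[OF j, of k] pos[OF j, of "Suc k"] by (simp add: powr_powr)
        then show ?thesis using pos[OF j, of "Suc k"] by (simp add: field_simps)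
      qed
      then show ?thesis unfolding b_def sum_distrib_left by (intro sum_mono) auto
    qed
    moreover have "0 < b k" for k unfolding b_def using B B_pos by (intro sum_pos) auto
    ultimately show False
      using escape_contradiction[of K "R / (c * \<beta>)" b u \<theta>] drift recur b_le u(1) \<theta> R c \<beta> by simp
  qed
  then have "x \<in> nash_equilibria A v" by (intro nash_if_advantage_nonpos x) (force simp: B_def not_less)
  moreover have "K \<longlonglongrightarrow> 0"
  proof (rule LIMSEQ_I)
    fix \<epsilon> :: real assume "0 < \<epsilon>"
    then obtain N where N: "K N < \<epsilon>" using recur by blast
    have "decseq K" using drift \<open>B = {}\<close> by (intro decseq_SucI) (simp add: b_def)
    then show "\<exists>N. \<forall>k\<ge>N. norm (K k - 0) < \<epsilon>" using N K_nonneg by (intro exI[of _ N]) (auto dest: decseqD le_less_trans)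
  qed
  ultimately show ?thesis by (auto simp: K_def[abs_def])
qed

end

theorem theorem9:
  fixes A :: "'n::finite \<Rightarrow> 'a::finite set"
    and v :: "'n \<Rightarrow> ('n,'a) profile \<Rightarrow> real"
    and g :: "'n \<Rightarrow> ('n,'a) profile \<Rightarrow> ('n,'a) profile"
    and G :: "'a set \<Rightarrow> ('a \<Rightarrow> real) \<Rightarrow> ('a \<Rightarrow> real) \<Rightarrow> ereal"
    and \<mu> :: real
    and \<sigma> :: "nat \<Rightarrow> ('n,'a) profile"
  assumes A_ne: "\<And>i. A i \<noteq> {}"
    and diff: "\<And>i \<pi>. \<pi> \<in> strat_space A \<Longrightarrow>
                 (v i has_derivative (\<lambda>h. g i \<pi> \<bullet> h)) (at \<pi> within strat_space A)"
    and monotone: "\<And>\<pi> \<pi>'. \<pi> \<in> strat_space A \<Longrightarrow> \<pi>' \<in> strat_space A \<Longrightarrow>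
                 (\<Sum>i\<in>UNIV. \<Sum>j\<in>A i. (g i \<pi> $ (i,j) - g i \<pi>' $ (i,j)) * (\<pi> $ (i,j) - \<pi>' $ (i,j))) \<le> 0"
    and G_choice: "(\<exists>\<alpha>. 0 < \<alpha> \<and> \<alpha> < 1 \<and> G = alpha_div \<alpha>)
                 \<or> (\<exists>\<alpha>. 0 < \<alpha> \<and> \<alpha> < 1 \<and> G = renyi_div \<alpha>)
                 \<or> G = rev_KL"
    and mu_pos: "0 < \<mu>"
    and init: "\<sigma> 0 \<in> strat_interior A"
    and step: "\<And>k. perturbed_eq A v G \<mu> (\<sigma> k) (\<sigma> (Suc k))"
  shows "(\<lambda>k. INF p\<in>nash_equilibria A v. KL A p (\<sigma> k)) \<longlonglongrightarrow> 0"
proof -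
  interpret monotone_game A v g by unfold_locales (fact A_ne diff monotone)+
  obtain c \<beta> where c: "0 < c" "0 < \<beta>"
    and prox: "\<And>\<sigma> x. \<sigma> \<in> strat_interior A \<Longrightarrow> perturbed_eq A v G \<mu> \<sigma> x \<Longrightarrow> \<exists>s t. prox_step c \<beta> \<sigma> x s t"
    using perturbed_eq_prox_step[OF G_choice mu_pos] by blast
  have int: "\<sigma> k \<in> strat_interior A" for k
    by (induction k) (use init prox[OF _ step] in \<open>auto simp: prox_step_def\<close>)
  have "\<forall>k. \<exists>s t. prox_step c \<beta> (\<sigma> k) (\<sigma> (Suc k)) s t" using prox[OF int step] by blast
  then obtain s t where st: "\<And>k. prox_step c \<beta> (\<sigma> k) (\<sigma> (Suc k)) (s k) (t k)" by metis
  interpret prox_sequence A v g \<sigma> s t c \<beta> by unfold_locales (fact c init st)+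
  obtain x where x: "x \<in> nash_equilibria A v" and lim: "(\<lambda>k. KL A x (\<sigma> k)) \<longlonglongrightarrow> 0"
    using converges_to_nash by blast
  have nonneg: "0 \<le> KL A p (\<sigma> k)" if "p \<in> nash_equilibria A v" for p k
    using that int by (intro KL_nonneg) (auto simp: nash_equilibria_def)
  show ?thesis
  proof (rule tendsto_sandwich[OF _ _ tendsto_const lim])
    show "\<forall>\<^sub>F k in sequentially. 0 \<le> (INF p\<in>nash_equilibria A v. KL A p (\<sigma> k))"
      using x nonneg by (intro always_eventually allI cINF_greatest) auto
    show "\<forall>\<^sub>F k in sequentially. (INF p\<in>nash_equilibria A v. KL A p (\<sigma> k)) \<le> KL A x (\<sigma> k)"
      using x nonneg by (intro always_eventually allI cINF_lower bdd_belowI2[of _ 0]) auto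
  qed
qed

end
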